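(* Suppose $f:\mathcal{X}\to\mathbb{R}$ is $\ell$-smooth where $\ell$ is sub-quadratic, let $x_0\in\mathcal{X}$, and suppose the stochastic gradients satisfy the noise assumption stated in the context with parameter $\sigma\ge0$. For any $0<\delta<1$, denote $F:=8(f(x_0)-f^*+\sigma)/\delta$ and $G:=\sup\{u\ge0\mid u^2\le2\ell(2u)\cdot F\}<\infty$. Denote $L:=\ell(2G)$ and choose $\eta>0$ and an integer $T\ge1$ with $\eta\le\min\left\{\frac{1}{2L},\frac{1}{4G\sqrt T}\right\}$ and $T\ge\frac{F}{\eta\epsilon^2}$, for any $\epsilon>0$. Then with probability at least $1-\delta$, the stochastic gradient descent iterates $x_{t+1}=x_t-\eta g_t$ satisfy $\|\nabla f(x_t)\|\le G$ for all $t<T$ and $$\frac1T\sum_{t<T}\|\nabla f(x_t)\|^2\le\epsilon^2.$$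
   Context: $\mathcal{X}\subseteq\mathbb{R}^d$ is the domain of $f$; $\|\cdot\|$ is the Euclidean norm for vectors and the operator norm for matrices. Standing assumptions: (1) $\mathcal{X}$ is open, $f$ is differentiable on $\mathcal{X}$ and closed, i.e. for each $a\in\mathbb{R}$ the sub-level set $\{x\in\mathcal{X}: f(x)\le a\}$ is closed (in $\mathbb{R}^d$); (2) $f^*:=\inf_{x\in\mathcal{X}}f(x)>-\infty$. $\ell$-smoothness: for a non-decreasing continuous function $\ell:[0,+\infty)\to(0,+\infty)$, a differentiable $f:\mathcal{X}\to\mathbb{R}$ is $\ell$-smooth if $\|\nabla^2f(x)\|\le\ell(\|\nabla f(x)\|)$ almost everywhere (with respect to the Lebesgue measure) in $\mathcal{X}$. $\ell$ is sub-quadratic if $\lim_{u\to\infty}\ell(u)/u^2=0$. Stochastic gradient descent: $x_0$ is deterministic and $x_{t+1}=x_t-\eta g_t$, where the random vector $g_t$ is an estimate of $\nabla f(x_t)$. The gradient noise is $\epsilon_t:=g_t-\nabla f(x_t)$. Noise assumption: for all $t\ge0$, $\mathbb{E}_{t-1}[\epsilon_t]=0$ and $\mathbb{E}_{t-1}[\|\epsilon_t\|^2]\le\sigma^2$, where $\mathbb{E}_{t-1}$ denotes the expectation conditioned on $\{g_s\}_{s<t}$. If $\mathcal{X}\ne\mathbb{R}^d$, these conditions are imposed on the event $x_0,\dots,x_t\in\mathcal{X}$ (where $\epsilon_t$ makes sense), and the conclusion includes that $x_t\in\mathcal{X}$ for all $t<T$. Conventions: $\frac{1}{4G\sqrt T}=+\infty$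 if $G=0$; sums over $t<T$ are over $t=0,\dots,T-1$.
   Formalization: ℓ-smoothness here also requires the gradient to be absolutely continuous along every line segment in X; with only the a.e. Hessian bound the claim fails (f' the Cantor function on R, ℓ a small constant, σ=0, x_0=2, T=1). *)

theory Defs
  imports "HOL-Probability.Probability"
begin

definition gradient :: "('a::euclidean_space \<Rightarrow> real) \<Rightarrow> 'a \<Rightarrow> 'a" where
  "gradient f x = (THE D. GDERIV f x :> D)"

text \<open>
  The classical epsilon-delta notion of absolute continuity on an interval. A division is a finite
  family of non-overlapping compact intervals, with \<open>Inf K\<close> and \<open>Sup K\<close> the end points of \<open>K\<close>.
\<close>

definition abs_continuous_on :: "real set \<Rightarrow> (real \<Rightarrow> 'a::real_normed_vector) \<Rightarrow> bool" where
  "abs_continuous_on S h \<longleftrightarrow>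
     (\<forall>\<epsilon>>0. \<exists>\<delta>>0. \<forall>\<D>. \<D> division_of \<Union>\<D> \<and> \<Union>\<D> \<subseteq> S \<and> (\<Sum>K\<in>\<D>. Sup K - Inf K) < \<delta> \<longrightarrow>
        (\<Sum>K\<in>\<D>. norm (h (Sup K) - h (Inf K))) < \<epsilon>)"

text \<open>
  Smoothness with respect to \<open>l\<close>: \<open>f\<close> is differentiable and the operator norm of its Hessian at \<open>x\<close> is
  at most \<open>l (norm (gradient f x))\<close> for almost every \<open>x \<in> X\<close>.

  A Hessian that exists only almost everywhere says nothing about \<open>f\<close> unless the gradient can be
  recovered from it by integration: if \<open>f'\<close> is the Cantor function on the real line then \<open>f'' = 0\<close>
  almost everywhere, so \<open>f\<close> would be smooth for every \<open>l\<close>. The Hessian is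
  therefore understood in the sense in which it is a derivative that determines the gradient, namely
  the gradient is absolutely continuous along line segments in \<open>X\<close>. This holds, for instance,
  whenever the gradient is locally Lipschitz, in particular for twice continuously differentiable \<open>f\<close>;
  no bound or modulus is prescribed.
\<close>

definition ell_smooth_on ::
    "(real \<Rightarrow> real) \<Rightarrow> 'a::euclidean_space set \<Rightarrow> ('a \<Rightarrow> real) \<Rightarrow> bool" where
  "ell_smooth_on l X f \<longleftrightarrow>
     f differentiable_on X \<and>
     (\<forall>x y. closed_segment x y \<subseteq> X \<longrightarrow>
        abs_continuous_on {0..1} (\<lambda>s. gradient f (x + s *\<^sub>R (y - x)))) \<and>
     (AE x in lebesgue. x \<in> X \<longrightarrow>
        gradient f differentiable (at x) \<and>
        onorm (frechet_derivative (gradient f) (at x)) \<le> l (norm (gradient f x)))"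

definition subquadratic :: "(real \<Rightarrow> real) \<Rightarrow> bool" where
  "subquadratic l \<longleftrightarrow> ((\<lambda>u. l u / u\<^sup>2) \<longlongrightarrow> 0) at_top"

primrec sgd :: "'a::real_vector \<Rightarrow> real \<Rightarrow> (nat \<Rightarrow> 'w \<Rightarrow> 'a) \<Rightarrow> nat \<Rightarrow> 'w \<Rightarrow> 'a" where
  "sgd x0 \<eta> g 0 \<omega> = x0"
| "sgd x0 \<eta> g (Suc t) \<omega> = sgd x0 \<eta> g t \<omega> - \<eta> *\<^sub>R g t \<omega>"

text \<open>The sigma-algebra generated by \<open>g s\<close> for \<open>s < t\<close>.\<close>

definition past :: "'w measure \<Rightarrow> (nat \<Rightarrow> 'w \<Rightarrow> 'a::topological_space) \<Rightarrow> nat \<Rightarrow> 'w measure" where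
  "past M g t = sigma (space M) {g s -` B \<inter> space M | s B. s < t \<and> B \<in> sets borel}"

text \<open>
  The gradient noise at time \<open>t\<close>, cut off to the event that the iterates up to time \<open>t\<close> lie in \<open>X\<close>.
  This event belongs to the past of \<open>t\<close>, so the conditional moments of the cut-off noise are those of
  the noise on the event and \<open>0\<close> off it. If \<open>X = UNIV\<close>, nothing is cut off.
\<close>

definition noise ::
    "'a::euclidean_space set \<Rightarrow> ('a \<Rightarrow> real) \<Rightarrow> 'a \<Rightarrow> real \<Rightarrow> (nat \<Rightarrow> 'w \<Rightarrow> 'a) \<Rightarrow> nat \<Rightarrow> 'w \<Rightarrow> 'a" where
  "noise X f x0 \<eta> g t \<omega> =
     (if \<forall>s\<le>t. sgd x0 \<eta> g s \<omega> \<in> X then g t \<omega> - gradient f (sgd x0 \<eta> g t \<omega>) else 0)"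

text \<open>
  The conditional mean is taken coordinatewise. The conditional second moment is the one of a
  nonnegative extended real function, so that no integrability is presupposed.
\<close>

definition noise_assumption ::
    "'w measure \<Rightarrow> 'a::euclidean_space set \<Rightarrow> ('a \<Rightarrow> real) \<Rightarrow> 'a \<Rightarrow> real \<Rightarrow> (nat \<Rightarrow> 'w \<Rightarrow> 'a) \<Rightarrow> real \<Rightarrow> bool"
  where
  "noise_assumption M X f x0 \<eta> g \<sigma> \<longleftrightarrow>
     (\<forall>t. g t \<in> borel_measurable M) \<and>
     (\<forall>t. \<forall>b\<in>Basis. AE \<omega> in M.
        real_cond_exp M (past M g t) (\<lambda>\<omega>. noise X f x0 \<eta> g t \<omega> \<bullet> b) \<omega> = 0) \<and>
     (\<forall>t. AE \<omega> in M.
        nn_cond_exp M (past M g t) (\<lambda>\<omega>. ennreal ((norm (noise X f x0 \<eta> g t \<omega>))\<^sup>2)) \<omega>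
          \<le> ennreal (\<sigma>\<^sup>2))"

end

theory Submission
  imports Defs
begin

text \<open>
  Write \<open>\<Delta> x = f x - f*\<close>, where \<open>f*\<close> is the infimum of \<open>f\<close>. The smoothness bound \<open>l\<close> is not uniform, so
  the usual descent argument is available only while the gradient stays bounded, and the gradient
  stays bounded only as long as descent keeps \<open>\<Delta>\<close> small. Two analytic facts close this circle.

  The first is a descent inequality (\<open>descent_in_ball\<close>): if the gradient at \<open>x\<close> has norm at most \<open>G\<close>,
  then the ball of radius \<open>G / l (2 G)\<close> around \<open>x\<close> lies in the domain, and on it \<open>f\<close> is below its
  quadratic model at \<open>x\<close> with constant \<open>l (2 G)\<close>. For almost every direction the Hessian bound holds
  almost everywhere on the ray from \<open>x\<close> (Fubini). On such a ray the gradient is absolutely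
  continuous, and as long as its norm is below \<open>2 G\<close> it moves at speed at most \<open>l (2 G)\<close>; hence it
  cannot reach norm \<open>2 G\<close> inside the ball. The ray cannot leave the domain either, because the model
  bounds \<open>f\<close> along it and sublevel sets are closed. The remaining directions follow by density and,
  again, closedness of the sublevel sets.

  The second (\<open>gradient_norm_bound\<close>) is obtained by applying the first to a gradient step:
  \<open>u\<^sup>2 \<le> 2 l (2 u) \<Delta> x\<close> for \<open>u\<close> the gradient norm at \<open>x\<close>. Therefore \<open>\<Delta> x \<le> F\<close> forces the gradient
  norm to be at most \<open>G\<close>, by the definition of \<open>G\<close> as a supremum.

  For the probabilistic part let \<open>L = l (2 G)\<close> and \<open>K = G / (2 \<eta> L)\<close>. While all \<open>\<Delta> x\<^sub>s\<close> are at most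
  \<open>F\<close> and all noise vectors \<open>n\<^sub>s\<close> have norm at most \<open>K\<close>, steps stay in the ball of the descent
  inequality. Let \<open>A\<^sub>t\<close> be the event that this has been so up to the choice of \<open>n\<^sub>t\<close>; it is determined by
  the past. The process is stopped when the noise is too large or \<open>\<Delta>\<close> exceeds \<open>F\<close>. The event that step
  \<open>t\<close> is executed depends on \<open>n\<^sub>t\<close>, which destroys the martingale property of
  \<open>\<langle>\<nabla>f(x\<^sub>t), n\<^sub>t\<rangle>\<close>. But on \<open>A\<^sub>t\<close> with \<open>norm n\<^sub>t > K\<close> this inner product is in absolute value at most
  \<open>G norm n\<^sub>t \<le> 2 \<eta> L (norm n\<^sub>t)\<^sup>2\<close>, so the indicator of the step can be replaced by that of \<open>A\<^sub>t\<close> at the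
  price of a larger multiple of \<open>(norm n\<^sub>t)\<^sup>2\<close>. The stopped energy is thus dominated, path by path, by
  \<open>R = \<Delta> x\<^sub>0 + \<Sum>t<T. 3 L \<eta>\<^sup>2 (norm n\<^sub>t)\<^sup>2 - \<eta> \<langle>1\<^bsub>A t\<^esub> \<nabla>f(x\<^sub>t), n\<^sub>t\<rangle>\<close>,
  whose expectation is at most \<open>\<Delta> x\<^sub>0 + \<sigma> = F \<delta> / 8\<close> by the choice of the step size and
  \<open>2 L F \<le> G\<^sup>2\<close>. Markov's inequality makes \<open>R \<ge> F / 2\<close> unlikely, Chebyshev's inequality makes large noise
  unlikely, and outside these two events the process never stops before \<open>T\<close> and the energy
  bounds the sum of the squared gradient norms (\<open>sgd_high_probability\<close>). If \<open>F = 0\<close>, there is no noise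
  and \<open>x0\<close> is a minimizer, so the iterates never move.
\<close>

section \<open>Absolutely continuous curves with almost everywhere bounded derivative\<close>

lemma gderiv_gradient:
  fixes f :: "'a::euclidean_space \<Rightarrow> real"
  assumes "open X" "f differentiable_on X" "x \<in> X"
  shows "GDERIV f x :> gradient f x"
proof -
  have "f differentiable (at x)"
    using assms by (metis at_within_open differentiable_on_def)
  then obtain f' where f': "(f has_derivative f') (at x)"
    unfolding differentiable_def by blast
  have lin: "linear f'"
    using f' has_derivative_linear by blast
  define D where "D = (\<Sum>b\<in>Basis. f' b *\<^sub>R b)"
  have "f' y = y \<bullet> D" for y
  proof -
    have "f' y = f' (\<Sum>b\<in>Basis. (y \<bullet> b) *\<^sub>R b)"
      by (simp add: euclidean_representation)
    also have "\<dots> = (\<Sum>b\<in>Basis. (y \<bullet> b) * f' b)"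
      using lin by (simp add: linear_sum linear_scale)
    finally show ?thesis
      by (simp add: D_def inner_sum_right mult.commute)
  qed
  then have D: "GDERIV f x :> D"
    using f' unfolding gderiv_def by presburger
  have unique: "E = D" if "GDERIV f x :> E" for E
  proof -
    have "(\<lambda>y. y \<bullet> E) = (\<lambda>y. y \<bullet> D)"
      using that D has_derivative_unique unfolding gderiv_def by blast
    then show ?thesis
      by (metis vector_eq_ldot)
  qed
  show ?thesis
    unfolding gradient_def using D unique by (rule theI)
qed

lemma abs_continuous_on_imp_continuous_on:
  assumes "abs_continuous_on {a..b} h"
  shows "continuous_on {a..b} h"
  unfolding continuous_on_iff
proof (intro ballI allI impI)
  fix x \<epsilon> :: real
  assume x: "x \<in> {a..b}" and "0 < \<epsilon>"
  then obtain \<delta> where \<delta>: "\<delta> > 0"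
    and ac: "\<And>\<D>. \<D> division_of \<Union>\<D> \<Longrightarrow> \<Union>\<D> \<subseteq> {a..b} \<Longrightarrow> (\<Sum>K\<in>\<D>. Sup K - Inf K) < \<delta> \<Longrightarrow>
        (\<Sum>K\<in>\<D>. norm (h (Sup K) - h (Inf K))) < \<epsilon>"
    using assms unfolding abs_continuous_on_def by meson
  have "dist (h y) (h x) < \<epsilon>" if y: "y \<in> {a..b}" "dist y x < \<delta>" for y
  proof -
    have *: "norm (h v - h u) < \<epsilon>" if "u \<le> v" "u \<in> {a..b}" "v \<in> {a..b}" "v - u < \<delta>" for u v
    proof -
      have "{cbox u v} division_of \<Union>{cbox u v}"
        using that division_of_self[of u v] by simp
      then show ?thesis
        using ac[of "{cbox u v}"] that by auto
    qed
    show ?thesis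
      using *[of x y] *[of y x] x y
      by (cases "x \<le> y") (auto simp: dist_norm norm_minus_commute)
  qed
  then show "\<exists>d>0. \<forall>y\<in>{a..b}. dist y x < d \<longrightarrow> dist (h y) (h x) < \<epsilon>"
    using \<delta> by blast
qed

text \<open>
  Choose an open set around the exceptional null set whose measure is below the modulus of absolute
  continuity, and apply Cousin's lemma to a gauge that stays inside this open set at exceptional points
  and expresses the derivative bound at the others. In a fine tagged division, the intervals tagged at
  exceptional points contribute less than \<open>e\<close> to the total variation of \<open>h\<close>, and the others at most
  \<open>B + e\<close> times their length.
\<close>

lemma abs_continuous_on_bound:
  fixes h :: "real \<Rightarrow> 'a::real_normed_vector"
  assumes ac: "abs_continuous_on S h" and sub: "{a..b} \<subseteq> S" and "a \<le> b" and "0 \<le> B"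
    and ae: "AE s in lborel. s \<in> {a..b} \<longrightarrow>
      (\<exists>D. (h has_vector_derivative D) (at s within {a..b}) \<and> norm D \<le> B)"
  shows "norm (h b - h a) \<le> B * (b - a)"
proof (rule field_le_epsilon)
  fix e' :: real
  assume "e' > 0"
  \<comment> \<open>Both errors of the estimate, \<open>e\<close> and \<open>e * (b - a)\<close>, must fit into \<open>e'\<close>.\<close>
  define e where "e = e' / (1 + (b - a))"
  have e: "e > 0"
    using \<open>e' > 0\<close> \<open>a \<le> b\<close> by (simp add: e_def)
  have "e * (1 + (b - a)) = e'"
    using \<open>a \<le> b\<close> by (simp add: e_def)
  then have e': "e + e * (b - a) = e'"
    by (simp add: distrib_left)
  obtain \<delta> where \<delta>: "\<delta> > 0"
    and acD: "\<And>\<D>. \<D> division_of \<Union>\<D> \<Longrightarrow> \<Union>\<D> \<subseteq> S \<Longrightarrow> (\<Sum>K\<in>\<D>. Sup K - Inf K) < \<delta> \<Longrightarrow>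
        (\<Sum>K\<in>\<D>. norm (h (Sup K) - h (Inf K))) < e"
    using ac e unfolding abs_continuous_on_def by meson
  obtain N where "N \<in> null_sets lborel"
    and "{s. \<not> (s \<in> {a..b} \<longrightarrow>
      (\<exists>D. (h has_vector_derivative D) (at s within {a..b}) \<and> norm D \<le> B))} \<subseteq> N"
    using ae unfolding eventually_ae_filter by auto
  then have N: "emeasure lborel N = 0" "N \<in> sets lborel"
    and good: "\<And>s. s \<in> {a..b} \<Longrightarrow> s \<notin> N \<Longrightarrow>
      \<exists>D. (h has_vector_derivative D) (at s within {a..b}) \<and> norm D \<le> B"
    by (auto simp: null_sets_def)
  obtain U where U: "open U" "N \<subseteq> U" and UN: "(U - N) \<in> lmeasurable"
    "emeasure lebesgue (U - N) < ennreal \<delta>"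
    using sets_lebesgue_outer_open[of N \<delta>] N \<delta> by auto
  have Nnull: "N \<in> null_sets lebesgue"
    using N by (simp add: null_sets_def)
  have Ueq: "emeasure lebesgue U = emeasure lebesgue (U - N)"
    using Nnull U by (metis emeasure_Diff_null_set lborelD borel_open sets_completionI_sets sets_lborel)
  have Ulm: "U \<in> lmeasurable"
    using UN Ueq U(1) by (auto simp: fmeasurable_def)
  have Ume: "measure lebesgue U < \<delta>"
    using UN Ueq Ulm by (metis \<delta> emeasure_eq_measure2 ennreal_less_iff measure_nonneg)
  have "\<exists>V. open V \<and> s \<in> V \<and> (s \<in> N \<longrightarrow> V \<subseteq> U) \<and>
      (s \<in> {a..b} \<longrightarrow> s \<notin> N \<longrightarrow> (\<forall>t\<in>V \<inter> {a..b}. norm (h t - h s) \<le> (B + e) * \<bar>t - s\<bar>))" for s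
  proof (cases "s \<in> {a..b} \<and> s \<notin> N")
    case True
    then obtain D where D: "(h has_vector_derivative D) (at s within {a..b})" "norm D \<le> B"
      using good by blast
    obtain d where d: "d > 0" and
      dd: "\<And>t. t \<in> {a..b} \<Longrightarrow> norm (t - s) < d \<Longrightarrow>
        norm (h t - h s - (t - s) *\<^sub>R D) \<le> e * norm (t - s)"
      using D(1) e unfolding has_vector_derivative_def has_derivative_within_alt by blast
    have "norm (h t - h s) \<le> (B + e) * \<bar>t - s\<bar>" if t: "t \<in> {a..b}" "norm (t - s) < d" for t
    proof -
      have "norm (h t - h s) \<le> norm (h t - h s - (t - s) *\<^sub>R D) + norm ((t - s) *\<^sub>R D)"
        by (metis diff_add_cancel norm_triangle_ineq)
      also have "\<dots> \<le> e * \<bar>t - s\<bar> + \<bar>t - s\<bar> * B"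
        using dd[OF t] D(2) by (intro add_mono) (auto intro: mult_left_mono)
      finally show ?thesis
        by (simp add: algebra_simps)
    qed
    then show ?thesis
      using True d by (intro exI[of _ "ball s d"]) (auto simp: dist_norm norm_minus_commute)
  next
    case False
    show ?thesis
    proof (cases "s \<in> N")
      case True
      then show ?thesis
        using U by blast
    next
      case no: False
      then show ?thesis
        using False by (intro exI[of _ UNIV]) auto
    qed
  qed
  then obtain V where V: "\<And>s. open (V s) \<and> s \<in> V s"
    and VN: "\<And>s. s \<in> N \<Longrightarrow> V s \<subseteq> U"
    and Vgood: "\<And>s t. s \<in> {a..b} \<Longrightarrow> s \<notin> N \<Longrightarrow> t \<in> V s \<Longrightarrow> t \<in> {a..b} \<Longrightarrow>
      norm (h t - h s) \<le> (B + e) * \<bar>t - s\<bar>"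
    by (metis IntI)
  have "gauge V"
    using V by (simp add: gauge_def)
  then obtain p where p: "p tagged_division_of {a..b}" and fine: "V fine p"
    using fine_division_exists_real by blast
  have finp: "finite p"
    using p by blast
  have pK: "\<exists>u v. K = cbox u v \<and> u \<le> v \<and> u \<le> s \<and> s \<le> v \<and> u \<in> {a..b} \<and> v \<in> {a..b} \<and> Sup K = v \<and> Inf K = u"
    if "(s, K) \<in> p" for s K
  proof -
    have sK: "s \<in> K" "K \<subseteq> {a..b}" and "\<exists>u v. K = cbox u v"
      using tagged_division_ofD(2-4)[OF p that] by auto
    then obtain u v where K: "K = cbox u v"
      by blast
    have "u \<le> v" "u \<le> s" "s \<le> v"
      using sK K by auto
    moreover have "u \<in> K" "v \<in> K"
      using K \<open>u \<le> v\<close> by auto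
    ultimately show ?thesis
      using sK K by auto
  qed
  let ?J = "\<lambda>K. norm (h (Sup K) - h (Inf K))"
  let ?p1 = "{(s, K). (s, K) \<in> p \<and> s \<in> N}"
  have sub1: "?p1 \<subseteq> p"
    by blast
  have "norm (h b - h a) = norm (\<Sum>(s, K)\<in>p. h (Sup K) - h (Inf K))"
    using additive_tagged_division_1[OF \<open>a \<le> b\<close> p, of h] by simp
  also have "\<dots> \<le> (\<Sum>(s, K)\<in>p. ?J K)"
    by (rule order_trans[OF norm_sum]) (simp add: case_prod_unfold)
  also have "\<dots> = (\<Sum>(s, K)\<in>?p1. ?J K) + (\<Sum>(s, K)\<in>p - ?p1. ?J K)"
    using sum.subset_diff[OF sub1 finp, of "\<lambda>(s, K). ?J K"] by simp
  finally have split: "norm (h b - h a) \<le> (\<Sum>(s, K)\<in>?p1. ?J K) + (\<Sum>(s, K)\<in>p - ?p1. ?J K)" .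
  have exceptional: "(\<Sum>(s, K)\<in>?p1. ?J K) < e"
  proof -
    let ?D = "snd ` ?p1"
    have part: "?p1 tagged_partial_division_of {a..b}"
      using p unfolding tagged_division_of_def
      by (elim conjE, intro tagged_partial_division_subset[OF _ sub1])
    have td: "?p1 tagged_division_of \<Union>?D"
      using tagged_partial_division_of_Union_self[OF part] .
    have div: "?D division_of \<Union>?D"
      using division_of_tagged_division[OF td] .
    have "K \<subseteq> S \<and> K \<subseteq> U" if "K \<in> ?D" for K
    proof -
      obtain s where s: "(s, K) \<in> p" "s \<in> N"
        using \<open>K \<in> ?D\<close> by auto
      have "K \<subseteq> V s"
        using fineD[OF fine s(1)] .
      then show ?thesis
        using tagged_division_ofD(3)[OF p s(1)] VN[OF s(2)] sub by blast
    qed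
    then have DS: "\<Union>?D \<subseteq> S" and DU: "\<Union>?D \<subseteq> U"
      by (meson Sup_least)+
    have "(\<Sum>K\<in>?D. Sup K - Inf K) = (\<Sum>K\<in>?D. measure lebesgue K)"
    proof (rule sum.cong[OF refl])
      fix K
      assume "K \<in> ?D"
      then obtain s where s: "(s, K) \<in> p"
        by auto
      show "Sup K - Inf K = measure lebesgue K"
        using pK[OF s] by (elim exE conjE) simp
    qed
    also have "\<dots> = measure lebesgue (\<Union>?D)"
      using content_division[OF div] .
    also have "\<dots> \<le> measure lebesgue U"
      using DU Ulm lmeasurable_division[OF div] by (intro measure_mono_fmeasurable) auto
    also have "\<dots> < \<delta>"
      by (rule Ume)
    finally have "(\<Sum>K\<in>?D. ?J K) < e"
      using acD[OF div DS] by blast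
    moreover have "(\<Sum>(s, K)\<in>?p1. ?J K) = (\<Sum>K\<in>?D. ?J K)"
    proof -
      \<comment> \<open>The lemma on sums over tagged divisions wants a summand that vanishes on degenerate intervals, including the empty one.\<close>
      let ?J' = "\<lambda>K. if K = {} then 0 else ?J K"
      have ne: "K \<noteq> {}" if "(s, K) \<in> p" for s K
        using tagged_division_ofD(2)[OF p that] by blast
      have "(\<Sum>(s, K)\<in>?p1. ?J K) = (\<Sum>(s, K)\<in>?p1. ?J' K)"
        using ne by (intro sum.cong) auto
      also have "\<dots> = (\<Sum>K\<in>?D. ?J' K)"
      proof (rule sum.over_tagged_division_lemma[OF td])
        fix u v :: real
        assume "box u v = {}"
        then have "v \<le> u"
          by auto
        then show "?J' (cbox u v) = 0"
          by (cases "u = v") auto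
      qed
      also have "\<dots> = (\<Sum>K\<in>?D. ?J K)"
        using ne by (intro sum.cong) auto
      finally show ?thesis .
    qed
    ultimately show ?thesis
      by simp
  qed
  have regular: "(\<Sum>(s, K)\<in>p - ?p1. ?J K) \<le> (B + e) * (b - a)"
  proof -
    have "(\<Sum>(s, K)\<in>p - ?p1. ?J K) \<le> (\<Sum>(s, K)\<in>p - ?p1. (B + e) * (Sup K - Inf K))"
    proof (rule sum_mono)
      fix q
      assume q: "q \<in> p - ?p1"
      obtain s K where sK: "q = (s, K)"
        by (cases q)
      then have in_p: "(s, K) \<in> p" and "s \<notin> N"
        using q by auto
      obtain u v where K: "K = cbox u v" "u \<le> s" "s \<le> v" "u \<in> {a..b}" "v \<in> {a..b}"
        "Sup K = v" "Inf K = u"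
        using pK[OF in_p] by blast
      have "s \<in> {a..b}"
        using K by auto
      moreover have "u \<in> K" "v \<in> K"
        using K by auto
      then have "u \<in> V s" "v \<in> V s"
        using fineD[OF fine in_p] by blast+
      ultimately have "norm (h v - h s) \<le> (B + e) * \<bar>v - s\<bar>" "norm (h u - h s) \<le> (B + e) * \<bar>u - s\<bar>"
        using Vgood \<open>s \<notin> N\<close> K by blast+
      then have "norm (h v - h u) \<le> (B + e) * (v - s) + (B + e) * (s - u)"
        using K norm_triangle_ineq4[of "h v - h s" "h u - h s"] by (simp add: norm_minus_commute)
      then show "(case q of (s, K) \<Rightarrow> ?J K) \<le> (case q of (s, K) \<Rightarrow> (B + e) * (Sup K - Inf K))"
        using sK K by (simp add: algebra_simps)
    qed
    also have "\<dots> \<le> (\<Sum>(s, K)\<in>p. (B + e) * (Sup K - Inf K))"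
    proof (rule sum_mono2[OF finp])
      fix q
      assume q: "q \<in> p - (p - ?p1)"
      obtain s K where sK: "q = (s, K)"
        by (cases q)
      then have in_p: "(s, K) \<in> p"
        using q by blast
      have "Inf K \<le> Sup K"
        using pK[OF in_p] by (elim exE conjE) simp
      then show "0 \<le> (case q of (s, K) \<Rightarrow> (B + e) * (Sup K - Inf K))"
        using sK \<open>0 \<le> B\<close> e by simp
    qed blast
    also have "\<dots> = (B + e) * (\<Sum>(s, K)\<in>p. Sup K - Inf K)"
      by (simp add: sum_distrib_left case_prod_unfold)
    also have "\<dots> = (B + e) * (b - a)"
      using additive_tagged_division_1[OF \<open>a \<le> b\<close> p, of "\<lambda>x. x"] by simp
    finally show ?thesis .
  qed
  have "(B + e) * (b - a) = B * (b - a) + e * (b - a)"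
    by (simp add: distrib_right)
  then show "norm (h b - h a) \<le> B * (b - a) + e'"
    using split exceptional regular e' by linarith
qed


section \<open>Almost every line through a point avoids a null set\<close>

lemma AE_lborel_affine:
  fixes t :: "'a::euclidean_space"
  assumes "AE z in lborel. P z" and "c \<noteq> 0"
  shows "AE y in lborel. P (t + c *\<^sub>R y)"
proof -
  obtain N where N: "N \<in> null_sets lborel" and "{z. \<not> P z} \<subseteq> N"
    using assms(1) by (auto simp: eventually_ae_filter)
  then have PN: "\<And>z. z \<notin> N \<Longrightarrow> P z"
    by blast
  have Nb: "N \<in> sets borel"
    using N by (auto simp: null_sets_def)
  have "AE z in density (distr lborel borel (\<lambda>x. t + c *\<^sub>R x)) (\<lambda>_. ennreal (\<bar>c\<bar> ^ DIM('a))). z \<notin> N"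
    using lborel_affine[OF assms(2), of t] AE_not_in[OF N] by metis
  then have "AE z in distr lborel borel (\<lambda>x. t + c *\<^sub>R x). z \<notin> N"
    using assms(2) by (subst (asm) AE_density) auto
  then have "AE y in lborel. t + c *\<^sub>R y \<notin> N"
    using Nb by (subst (asm) AE_distr_iff) auto
  then show ?thesis
    by (rule eventually_mono) (rule PN)
qed

text \<open>
  For fixed \<open>s \<noteq> 0\<close> the map \<open>v \<mapsto> x + s *\<^sub>R v\<close> preserves null sets, so Fubini's theorem exchanges the
  quantifiers. This transfers the Hessian bound from the domain to rays, which themselves are null
  sets in dimension at least two.
\<close>

lemma AE_lborel_lines:
  fixes x :: "'a::euclidean_space"
  assumes "AE z in lborel. P z"
  shows "AE v in lborel. AE s in lborel. P (x + s *\<^sub>R v)"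
proof -
  obtain N where N: "N \<in> null_sets lborel" and "{z. \<not> P z} \<subseteq> N"
    using assms by (auto simp: eventually_ae_filter)
  then have PN: "\<And>z. z \<notin> N \<Longrightarrow> P z"
    by blast
  have Nb[measurable]: "N \<in> sets borel"
    using N by (auto simp: null_sets_def)
  have "AE v in lborel. x + s *\<^sub>R v \<notin> N" if "s \<noteq> 0" for s
    using AE_lborel_affine[OF AE_not_in[OF N] that] .
  then have "AE s in lborel. AE v in lborel. x + s *\<^sub>R v \<notin> N"
    by (rule eventually_mono[OF AE_lborel_singleton[of 0]])
  moreover have "{p \<in> space (lborel \<Otimes>\<^sub>M lborel). x + fst p *\<^sub>R snd p \<notin> N}
      \<in> sets (lborel \<Otimes>\<^sub>M lborel)"
    by measurable
  ultimately have "AE v in lborel. AE s in lborel. x + s *\<^sub>R v \<notin> N"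
    by (subst (asm) lborel_pair.AE_commute)
  then show ?thesis
    by (elim eventually_mono) (auto elim: eventually_mono intro: PN)
qed

section \<open>The descent inequality\<close>

definition regular_point :: "(real \<Rightarrow> real) \<Rightarrow> ('a::euclidean_space \<Rightarrow> real) \<Rightarrow> 'a \<Rightarrow> bool" where
  "regular_point l f z \<longleftrightarrow> gradient f differentiable (at z) \<and>
     onorm (frechet_derivative (gradient f) (at z)) \<le> l (norm (gradient f z))"

lemma gradient_has_bounded_derivative_along_line:
  assumes "regular_point l f (x + s *\<^sub>R v)"
  shows "\<exists>D. ((\<lambda>s. gradient f (x + s *\<^sub>R v)) has_vector_derivative D) (at s within A) \<and>
    norm D \<le> l (norm (gradient f (x + s *\<^sub>R v))) * norm v"
proof -
  let ?H = "frechet_derivative (gradient f) (at (x + s *\<^sub>R v))"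
  have H: "(gradient f has_derivative ?H) (at (x + s *\<^sub>R v))"
    using assms by (simp add: regular_point_def frechet_derivative_works)
  have bl: "bounded_linear ?H"
    using H by (rule has_derivative_bounded_linear)
  have "((\<lambda>s. x + s *\<^sub>R v) has_vector_derivative v) (at s within A)"
    by (auto intro!: derivative_eq_intros simp: has_vector_derivative_def)
  then have "((gradient f \<circ> (\<lambda>s. x + s *\<^sub>R v)) has_vector_derivative ?H v) (at s within A)"
    by (rule vector_derivative_diff_chain_within) (rule has_derivative_at_withinI[OF H])
  moreover have "norm (?H v) \<le> l (norm (gradient f (x + s *\<^sub>R v))) * norm v"
    using onorm[OF bl, of v] assms unfolding regular_point_def
    by (meson mult_right_mono norm_ge_zero order_trans)
  ultimately show ?thesis
    by (auto simp: comp_def)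
qed

lemma closed_segment_add:
  "closed_segment x (x + v) = (\<lambda>s. x + s *\<^sub>R v) ` {0..1::real}"
  by (simp add: closed_segment_image_interval algebra_simps)

text \<open>
  The bound on the speed of the gradient depends on the size of the gradient itself, so it is
  established together with the bound \<open>2 * G\<close> by looking at the first parameter \<open>m\<close> at which the
  gradient norm reaches \<open>2 * G\<close>: before \<open>m\<close> the speed is at most \<open>l (2 * G) * norm v < G\<close>, so the
  gradient has not had time to grow from norm \<open>G\<close> to norm \<open>2 * G\<close>.
\<close>

lemma gradient_growth_along_segment:
  fixes f :: "'a::euclidean_space \<Rightarrow> real"
  assumes smooth: "ell_smooth_on l X f"
    and l: "mono_on {0..} l" "\<And>u. u \<ge> 0 \<Longrightarrow> l u > 0"
    and seg: "closed_segment x (x + v) \<subseteq> X"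
    and reg: "AE s in lborel. x + s *\<^sub>R v \<in> X \<longrightarrow> regular_point l f (x + s *\<^sub>R v)"
    and grad: "norm (gradient f x) \<le> G" and v: "norm v < G / l (2 * G)"
    and s: "s \<in> {0..1}"
  shows "norm (gradient f (x + s *\<^sub>R v) - gradient f x) \<le> l (2 * G) * norm v * s"
proof -
  define h where "h = (\<lambda>s. gradient f (x + s *\<^sub>R v))"
  have G: "G \<ge> 0"
    using grad norm_ge_zero order_trans by blast
  then have L: "l (2 * G) > 0"
    using l(2) by simp
  have vG: "l (2 * G) * norm v < G"
    using v L by (simp add: field_simps)
  have ac: "abs_continuous_on {0..1} h"
    using smooth seg unfolding ell_smooth_on_def h_def by (metis add_diff_cancel_left')
  have inX: "x + r *\<^sub>R v \<in> X" if "r \<in> {0..1}" for r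
    using seg that unfolding closed_segment_add by blast
  have bound: "norm (h m - h 0) \<le> l (2 * G) * norm v * m"
    if m: "m \<in> {0..1}" and below: "\<And>r. r \<in> {0..<m} \<Longrightarrow> norm (h r) \<le> 2 * G" for m
  proof -
    have "AE r in lborel. r \<in> {0..m} \<longrightarrow>
        (\<exists>D. (h has_vector_derivative D) (at r within {0..m}) \<and> norm D \<le> l (2 * G) * norm v)"
      using reg AE_lborel_singleton[of m]
    proof eventually_elim
      case (elim r)
      show ?case
      proof
        assume r: "r \<in> {0..m}"
        then have "regular_point l f (x + r *\<^sub>R v)"
          using elim inX[of r] m by simp
        then obtain D where D: "(h has_vector_derivative D) (at r within {0..m})"
          "norm D \<le> l (norm (h r)) * norm v"
          using gradient_has_bounded_derivative_along_line unfolding h_def by blast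
        have "l (norm (h r)) \<le> l (2 * G)"
          using below[of r] r elim G by (intro mono_onD[OF l(1)]) auto
        then have "norm D \<le> l (2 * G) * norm v"
          using D(2) by (meson mult_right_mono norm_ge_zero order_trans)
        then show "\<exists>D. (h has_vector_derivative D) (at r within {0..m}) \<and> norm D \<le> l (2 * G) * norm v"
          using D(1) by blast
      qed
    qed
    from abs_continuous_on_bound[OF ac _ _ _ this] show ?thesis
      using m L by simp
  qed
  define Z where "Z = {r \<in> {0..1}. 2 * G \<le> norm (h r)}"
  have "Z = {}"
  proof (rule ccontr)
    assume "Z \<noteq> {}"
    have "continuous_on {0..1} (\<lambda>r. norm (h r))"
      using abs_continuous_on_imp_continuous_on[OF ac] by (rule continuous_on_norm)
    then have "closed Z"
      unfolding Z_def using continuous_closed_preimage[of "{0..1}" "\<lambda>r. norm (h r)" "{2 * G..}"]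
      by (simp add: vimage_def Int_def)
    have "Z \<subseteq> {0..1}"
      by (auto simp: Z_def)
    then have "bounded Z"
      by (rule bounded_subset[OF bounded_closed_interval])
    with \<open>closed Z\<close> have "compact Z"
      by (simp add: compact_eq_bounded_closed)
    then obtain m where m: "m \<in> Z" "\<And>r. r \<in> Z \<Longrightarrow> m \<le> r"
      using \<open>Z \<noteq> {}\<close> by (meson compact_attains_inf)
    have "norm (h r) \<le> 2 * G" if "r \<in> {0..<m}" for r
    proof (rule ccontr)
      assume "\<not> norm (h r) \<le> 2 * G"
      then have "r \<in> Z"
        using that m(1) by (simp add: Z_def)
      then show False
        using m(2)[of r] that by simp
    qed
    then have "norm (h m - h 0) \<le> l (2 * G) * norm v * m"
      using bound m(1) unfolding Z_def by blast
    also have "\<dots> \<le> l (2 * G) * norm v"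
      using m(1) L by (intro mult_left_le) (auto simp: Z_def)
    finally have "norm (h m - h 0) < G"
      using vG by simp
    moreover have "norm (h 0) \<le> G"
      using grad by (simp add: h_def)
    ultimately have "norm (h m) < 2 * G"
      using norm_triangle_sub[of "h m" "h 0"] by simp
    then show False
      using m(1) by (simp add: Z_def)
  qed
  have "norm (h r) \<le> 2 * G" if "r \<in> {0..1}" for r
  proof (rule ccontr)
    assume "\<not> norm (h r) \<le> 2 * G"
    then have "r \<in> Z"
      using that by (simp add: Z_def)
    then show False
      using \<open>Z = {}\<close> by simp
  qed
  then have "norm (h s - h 0) \<le> l (2 * G) * norm v * s"
    using s by (intro bound) simp_all
  moreover have "h s = gradient f (x + s *\<^sub>R v)" "h 0 = gradient f x"
    by (simp_all add: h_def)
  ultimately show ?thesis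
    by (simp only:)
qed

text \<open>
  The difference \<open>\<psi>\<close> between \<open>f\<close> and the quadratic model has nonpositive derivative along the segment,
  by the growth bound for the gradient.
\<close>

lemma descent_along_regular_segment:
  fixes f :: "'a::euclidean_space \<Rightarrow> real"
  assumes "open X" and smooth: "ell_smooth_on l X f"
    and l: "mono_on {0..} l" "\<And>u. u \<ge> 0 \<Longrightarrow> l u > 0"
    and seg: "closed_segment x (x + v) \<subseteq> X"
    and reg: "AE s in lborel. x + s *\<^sub>R v \<in> X \<longrightarrow> regular_point l f (x + s *\<^sub>R v)"
    and grad: "norm (gradient f x) \<le> G" and v: "norm v < G / l (2 * G)"
  shows "f (x + v) \<le> f x + gradient f x \<bullet> v + l (2 * G) / 2 * (norm v)\<^sup>2"
proof -
  let ?L = "l (2 * G)"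
  define \<psi> where "\<psi> = (\<lambda>s. f (x + s *\<^sub>R v) - s * (gradient f x \<bullet> v) - ?L * s\<^sup>2 / 2 * (norm v)\<^sup>2)"
  have "\<exists>y. DERIV \<psi> s :> y \<and> y \<le> 0" if s: "0 \<le> s" "s \<le> 1" for s
  proof -
    have "s \<in> {0..1}"
      using s by simp
    then have "x + s *\<^sub>R v \<in> X"
      using seg unfolding closed_segment_add by blast
    then have "(f has_derivative (\<lambda>y. y \<bullet> gradient f (x + s *\<^sub>R v))) (at (x + s *\<^sub>R v))"
      using gderiv_gradient assms(1) smooth unfolding ell_smooth_on_def gderiv_def by blast
    then have "((\<lambda>s. f (x + s *\<^sub>R v)) has_derivative (\<lambda>t. (t *\<^sub>R v) \<bullet> gradient f (x + s *\<^sub>R v))) (at s)"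
      by (rule has_derivative_compose[rotated]) (auto intro!: derivative_eq_intros)
    then have "DERIV (\<lambda>s. f (x + s *\<^sub>R v)) s :> gradient f (x + s *\<^sub>R v) \<bullet> v"
      by (simp add: has_field_derivative_def inner_commute mult_commute_abs)
    then have "DERIV \<psi> s :> gradient f (x + s *\<^sub>R v) \<bullet> v - gradient f x \<bullet> v - ?L * s * (norm v)\<^sup>2"
      unfolding \<psi>_def by (auto intro!: derivative_eq_intros)
    moreover have "(gradient f (x + s *\<^sub>R v) - gradient f x) \<bullet> v \<le> (?L * norm v * s) * norm v"
      using gradient_growth_along_segment[OF smooth l seg reg grad v, of s] s
      by (intro order_trans[OF norm_cauchy_schwarz mult_right_mono]) auto
    ultimately show ?thesis
      by (intro exI conjI) (auto simp: inner_diff_left power2_eq_square mult_ac)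
  qed
  then have "\<psi> 1 \<le> \<psi> 0"
    by (intro DERIV_nonpos_imp_nonincreasing[of 0 1 \<psi>]) auto
  then show ?thesis
    by (simp add: \<psi>_def)
qed

text \<open>
  Let \<open>m\<close> be the first parameter at which the ray is outside \<open>X\<close>. Before \<open>m\<close> the descent inequality
  bounds \<open>f\<close> by a constant \<open>a\<close>, so these points lie in the closed set \<open>{x \<in> X. f x \<le> a}\<close>, and so does
  their limit at \<open>m\<close>.
\<close>

lemma regular_segment_stays_in_domain:
  fixes f :: "'a::euclidean_space \<Rightarrow> real"
  assumes "open X" and closed: "\<And>a. closed {x \<in> X. f x \<le> a}" and smooth: "ell_smooth_on l X f"
    and l: "mono_on {0..} l" "\<And>u. u \<ge> 0 \<Longrightarrow> l u > 0"
    and "x \<in> X"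
    and reg: "AE s in lborel. x + s *\<^sub>R v \<in> X \<longrightarrow> regular_point l f (x + s *\<^sub>R v)"
    and grad: "norm (gradient f x) \<le> G" and v: "norm v < G / l (2 * G)"
  shows "closed_segment x (x + v) \<subseteq> X"
proof -
  let ?L = "l (2 * G)"
  define Z where "Z = {s \<in> {0..1::real}. x + s *\<^sub>R v \<notin> X}"
  have "G \<ge> 0"
    using grad norm_ge_zero order_trans by blast
  then have L: "?L > 0"
    using l(2) by simp
  have "Z = {}"
  proof (rule ccontr)
    assume "Z \<noteq> {}"
    have "closed ((\<lambda>s. x + s *\<^sub>R v) -` (- X))"
      using \<open>open X\<close> by (intro closed_vimage) (auto intro!: continuous_intros)
    then have "closed ({0..1} \<inter> (\<lambda>s. x + s *\<^sub>R v) -` (- X))"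
      by (intro closed_Int) auto
    then have "closed Z"
      by (simp add: Z_def vimage_def Int_def)
    have "Z \<subseteq> {0..1}"
      by (auto simp: Z_def)
    then have "bounded Z"
      by (rule bounded_subset[OF bounded_closed_interval])
    with \<open>closed Z\<close> have "compact Z"
      by (simp add: compact_eq_bounded_closed)
    then obtain m where m: "m \<in> Z" "\<And>r. r \<in> Z \<Longrightarrow> m \<le> r"
      using \<open>Z \<noteq> {}\<close> by (meson compact_attains_inf)
    have "m \<noteq> 0"
      using m(1) \<open>x \<in> X\<close> by (auto simp: Z_def)
    then have m01: "0 < m" "m \<le> 1"
      using m(1) by (auto simp: Z_def)
    let ?a = "f x + G * norm v + ?L / 2 * (norm v)\<^sup>2"
    have below: "x + r *\<^sub>R v \<in> {x \<in> X. f x \<le> ?a}" if r: "0 < r" "r < m" for r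
    proof -
      have inX: "x + q *\<^sub>R v \<in> X" if "0 \<le> q" "q \<le> r" for q
        using m(2)[of q] m01 that r by (force simp: Z_def)
      have seg: "closed_segment x (x + r *\<^sub>R v) \<subseteq> X"
      proof
        fix z
        assume "z \<in> closed_segment x (x + r *\<^sub>R v)"
        then obtain u where "0 \<le> u" "u \<le> 1" "z = x + (u * r) *\<^sub>R v"
          by (auto simp: closed_segment_add)
        then show "z \<in> X"
          using inX[of "u * r"] r by (simp add: mult_left_le_one_le)
      qed
      \<comment> \<open>Regularity along \<open>v\<close> is inherited by the shorter vector \<open>r *\<^sub>R v\<close> by rescaling the parameter.\<close>
      have "AE s in lborel. x + (0 + r *\<^sub>R s) *\<^sub>R v \<in> X \<longrightarrow> regular_point l f (x + (0 + r *\<^sub>R s) *\<^sub>R v)"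
        using reg r by (intro AE_lborel_affine) auto
      then have reg': "AE s in lborel. x + s *\<^sub>R r *\<^sub>R v \<in> X \<longrightarrow> regular_point l f (x + s *\<^sub>R r *\<^sub>R v)"
        by (simp add: mult.commute)
      have rv: "norm (r *\<^sub>R v) \<le> norm v"
        using r m01 by (simp add: mult_left_le_one_le)
      have "f (x + r *\<^sub>R v) \<le> f x + gradient f x \<bullet> (r *\<^sub>R v) + ?L / 2 * (norm (r *\<^sub>R v))\<^sup>2"
        using rv v by (intro descent_along_regular_segment[OF \<open>open X\<close> smooth l seg reg' grad]) auto
      also have "gradient f x \<bullet> (r *\<^sub>R v) \<le> G * norm v"
        using grad rv \<open>G \<ge> 0\<close> by (intro order_trans[OF norm_cauchy_schwarz mult_mono]) auto
      also have "?L / 2 * (norm (r *\<^sub>R v))\<^sup>2 \<le> ?L / 2 * (norm v)\<^sup>2"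
        using rv L by (intro mult_left_mono power_mono) auto
      finally show ?thesis
        using inX[of r] r by simp
    qed
    have "((\<lambda>r. x + r *\<^sub>R v) \<longlongrightarrow> x + m *\<^sub>R v) (at_left m)"
      by (intro tendsto_intros)
    moreover have "eventually (\<lambda>r. x + r *\<^sub>R v \<in> {x \<in> X. f x \<le> ?a}) (at_left m)"
      using eventually_at_left_real[OF m01(1)] by eventually_elim (rule below, auto)
    ultimately have "x + m *\<^sub>R v \<in> {x \<in> X. f x \<le> ?a}"
      by (intro Lim_in_closed_set[OF closed]) (auto simp: trivial_limit_at_left_real)
    then show False
      using m(1) by (simp add: Z_def)
  qed
  then have inX: "x + s *\<^sub>R v \<in> X" if "s \<in> {0..1}" for s
    using that by (auto simp: Z_def)
  then show ?thesis
    unfolding closed_segment_add by blast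
qed

text \<open>
  Regular directions have full measure, and for them the segment stays in \<open>X\<close> and the inequality
  holds. For an arbitrary \<open>v\<close> and any \<open>a\<close> above the value of the quadratic model at \<open>v\<close>, the nearby
  regular directions lead into the closed set \<open>{z \<in> X. f z \<le> a}\<close>. Hence \<open>x + v\<close> is in this set too, which
  gives both conclusions at once. The radial approach
  \<open>r *\<^sub>R v \<rightarrow> v\<close> covers the boundary of the ball, where the growth bound, stated for the open ball, does not apply.
\<close>

lemma descent_in_ball:
  fixes f :: "'a::euclidean_space \<Rightarrow> real"
  assumes "open X" and closed: "\<And>a. closed {x \<in> X. f x \<le> a}" and smooth: "ell_smooth_on l X f"
    and l: "mono_on {0..} l" "\<And>u. u \<ge> 0 \<Longrightarrow> l u > 0"
    and "x \<in> X" and grad: "norm (gradient f x) \<le> G" and "0 < G"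
    and v: "norm v \<le> G / l (2 * G)"
  shows "x + v \<in> X \<and> f (x + v) \<le> f x + gradient f x \<bullet> v + l (2 * G) / 2 * (norm v)\<^sup>2"
proof -
  let ?q = "\<lambda>v. f x + gradient f x \<bullet> v + l (2 * G) / 2 * (norm v)\<^sup>2"
  have L: "l (2 * G) > 0"
    using \<open>0 < G\<close> l(2) by simp
  have "AE z in lebesgue. z \<in> X \<longrightarrow> regular_point l f z"
    using smooth by (simp add: ell_smooth_on_def regular_point_def)
  then have "AE z in lborel. z \<in> X \<longrightarrow> regular_point l f z"
    by (simp add: AE_completion_iff)
  then have lines: "AE w in lborel. AE s in lborel.
      x + s *\<^sub>R w \<in> X \<longrightarrow> regular_point l f (x + s *\<^sub>R w)"
    by (rule AE_lborel_lines)
  have key: "x + v \<in> {z \<in> X. f z \<le> a}" if a: "?q v < a" for a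
  proof -
    define U where "U = ball 0 (G / l (2 * G)) \<inter> {w. ?q w < a}"
    define C where "C = {w. x + w \<in> {z \<in> X. f z \<le> a}}"
    have "open {w. ?q w < a}"
      by (intro open_Collect_less continuous_intros)
    then have "open U"
      by (simp add: U_def open_Int)
    have "closed ((\<lambda>w. x + w) -` {z \<in> X. f z \<le> a})"
      by (intro closed_vimage closed continuous_intros)
    then have "closed C"
      by (simp add: C_def vimage_def)
    have "AE w in lborel. w \<in> U \<longrightarrow> w \<in> C"
      using lines
    proof eventually_elim
      case (elim w)
      show ?case
      proof
        assume w: "w \<in> U"
        then have small: "norm w < G / l (2 * G)"
          by (simp add: U_def)
        have seg: "closed_segment x (x + w) \<subseteq> X"
          by (rule regular_segment_stays_in_domain
              [OF \<open>open X\<close> closed smooth l \<open>x \<in> X\<close> elim grad small])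
        have "f (x + w) \<le> ?q w"
          by (rule descent_along_regular_segment[OF \<open>open X\<close> smooth l seg elim grad small])
        then show "w \<in> C"
          using w seg by (auto simp: U_def C_def)
      qed
    qed
    then have ae: "AE w \<in> U in lebesgue. w \<in> C"
      by (simp add: AE_completion_iff)
    have "((\<lambda>r. r *\<^sub>R v) \<longlongrightarrow> 1 *\<^sub>R v) (at_left (1::real))"
      by (intro tendsto_intros)
    moreover have "eventually (\<lambda>r. r *\<^sub>R v \<in> C) (at_left (1::real))"
    proof -
      have "((\<lambda>r. ?q (r *\<^sub>R v)) \<longlongrightarrow> ?q (1 *\<^sub>R v)) (at_left (1::real))"
        by (intro tendsto_intros)
      then have "eventually (\<lambda>r. ?q (r *\<^sub>R v) < a) (at_left (1::real))"
        using a by (intro order_tendstoD) auto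
      moreover have "eventually (\<lambda>r::real. r \<in> {0<..<1}) (at_left 1)"
        by (rule eventually_at_left_real) simp
      ultimately show ?thesis
      proof eventually_elim
        case (elim r)
        have "norm (r *\<^sub>R v) < G / l (2 * G)"
        proof (cases "v = 0")
          case True
          then show ?thesis
            using \<open>0 < G\<close> L by simp
        next
          case False
          then have "r * norm v < norm v"
            using elim by simp
          then show ?thesis
            using elim v by simp
        qed
        then have "r *\<^sub>R v \<in> U"
          using elim by (simp add: U_def)
        then show ?case
          by (rule mem_closed_if_AE_lebesgue_open[OF \<open>open U\<close> \<open>closed C\<close> ae])
      qed
    qed
    ultimately have "1 *\<^sub>R v \<in> C"
      by (intro Lim_in_closed_set[OF \<open>closed C\<close>]) (auto simp: trivial_limit_at_left_real)
    then show ?thesis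
      by (simp add: C_def)
  qed
  have "x + v \<in> X"
    using key[of "?q v + 1"] by simp
  moreover have "f (x + v) \<le> ?q v"
  proof (rule dense_ge)
    fix a
    assume "?q v < a"
    from key[OF this] show "f (x + v) \<le> a"
      by simp
  qed
  ultimately show ?thesis
    by simp
qed

text \<open>
  Take the step \<open>- gradient f x / l (2 * G)\<close> with \<open>G\<close> the gradient norm at \<open>x\<close>: it just reaches the
  boundary of the ball of the descent inequality, and \<open>f\<close> cannot fall below \<open>m\<close> there.
\<close>

lemma gradient_norm_bound:
  fixes f :: "'a::euclidean_space \<Rightarrow> real"
  assumes "open X" and closed: "\<And>a. closed {x \<in> X. f x \<le> a}" and smooth: "ell_smooth_on l X f"
    and l: "mono_on {0..} l" "\<And>u. u \<ge> 0 \<Longrightarrow> l u > 0"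
    and "x \<in> X" and lower: "\<And>z. z \<in> X \<Longrightarrow> m \<le> f z"
  shows "(norm (gradient f x))\<^sup>2 \<le> 2 * l (2 * norm (gradient f x)) * (f x - m)"
proof (cases "gradient f x = 0")
  case True
  then show ?thesis
    using lower[OF \<open>x \<in> X\<close>] l(2)[of 0] by simp
next
  case False
  define G where "G = norm (gradient f x)"
  let ?L = "l (2 * G)"
  have G: "0 < G"
    using False by (simp add: G_def)
  then have L: "?L > 0"
    using l(2) by simp
  define v where "v = - (1 / ?L) *\<^sub>R gradient f x"
  have nv: "norm v = G / ?L"
    using L by (simp add: v_def G_def)
  have "gradient f x \<bullet> v = - G\<^sup>2 / ?L"
    by (simp add: v_def G_def power2_norm_eq_inner)
  moreover have "x + v \<in> X" "f (x + v) \<le> f x + gradient f x \<bullet> v + ?L / 2 * (norm v)\<^sup>2"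
    using descent_in_ball[OF \<open>open X\<close> closed smooth l \<open>x \<in> X\<close> _ G, of v] nv by (auto simp: G_def)
  ultimately have "m \<le> f x - G\<^sup>2 / ?L + ?L / 2 * (G / ?L)\<^sup>2"
    using lower[of "x + v"] nv by simp
  also have "\<dots> = f x - G\<^sup>2 / (2 * ?L)"
    using L by (simp add: field_simps power2_eq_square)
  finally show ?thesis
    using L by (simp add: G_def field_simps)
qed

section \<open>Measurability and moments of the noise\<close>

text \<open>
  The partial derivatives are pointwise limits of difference quotients. Outside \<open>X\<close> the gradient may be
  arbitrary, hence the cut-off.
\<close>

lemma borel_measurable_gradient:
  fixes f :: "'a::euclidean_space \<Rightarrow> real"
  assumes "open X" and diff: "f differentiable_on X"
  shows "(\<lambda>x. if x \<in> X then gradient f x else 0) \<in> borel_measurable borel"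
proof (rule borel_measurable_euclidean_space[THEN iffD2], intro ballI)
  fix b :: 'a
  assume "b \<in> Basis"
  define f' where "f' = (\<lambda>x. if x \<in> X then f x else 0)"
  have X[measurable]: "X \<in> sets borel"
    using \<open>open X\<close> by simp
  have [measurable]: "f' \<in> borel_measurable borel"
    unfolding f'_def
    using borel_measurable_continuous_on_indicator[OF X differentiable_imp_continuous_on[OF diff]]
    by (rule measurable_cong[THEN iffD1, rotated]) (simp add: indicator_def)
  let ?q = "\<lambda>n x. if x \<in> X then real (Suc n) * (f' (x + (1 / real (Suc n)) *\<^sub>R b) - f' x) else 0"
  show "(\<lambda>x. (if x \<in> X then gradient f x else 0) \<bullet> b) \<in> borel_measurable borel"
  proof (rule borel_measurable_LIMSEQ_real)
    fix x :: 'a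
    show "(\<lambda>n. ?q n x) \<longlonglongrightarrow> (if x \<in> X then gradient f x else 0) \<bullet> b"
    proof (cases "x \<in> X")
      case True
      have lim0: "filterlim (\<lambda>n. 1 / real (Suc n)) (at 0) sequentially"
        using LIMSEQ_inverse_real_of_nat by (intro filterlim_atI) (auto simp: inverse_eq_divide)
      have "((\<lambda>t. x + t *\<^sub>R b) \<longlongrightarrow> x + 0 *\<^sub>R b) (at (0::real))"
        by (intro tendsto_intros)
      then have "eventually (\<lambda>t. x + t *\<^sub>R b \<in> X) (at (0::real))"
        using True \<open>open X\<close> by (intro topological_tendstoD) auto
      then have near: "eventually (\<lambda>n. x + (1 / real (Suc n)) *\<^sub>R b \<in> X) sequentially"
        using lim0 by (rule eventually_compose_filterlim)
      have "(f has_derivative (\<lambda>y. y \<bullet> gradient f x)) (at (x + 0 *\<^sub>R b))"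
        using gderiv_gradient[OF assms True] by (simp add: gderiv_def)
      then have "((\<lambda>t. f (x + t *\<^sub>R b)) has_derivative (\<lambda>t. (t *\<^sub>R b) \<bullet> gradient f x)) (at (0::real))"
        by (rule has_derivative_compose[rotated]) (auto intro!: derivative_eq_intros)
      then have "DERIV (\<lambda>t. f (x + t *\<^sub>R b)) 0 :> gradient f x \<bullet> b"
        by (simp add: has_field_derivative_def inner_commute mult_commute_abs)
      then have "((\<lambda>t. (f (x + t *\<^sub>R b) - f x) / t) \<longlongrightarrow> gradient f x \<bullet> b) (at 0)"
        by (simp add: DERIV_def)
      then have "(\<lambda>n. (f (x + (1 / real (Suc n)) *\<^sub>R b) - f x) / (1 / real (Suc n))) \<longlonglongrightarrow> gradient f x \<bullet> b"
        using lim0 by (rule filterlim_compose)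
      moreover have "eventually (\<lambda>n. (f (x + (1 / real (Suc n)) *\<^sub>R b) - f x) / (1 / real (Suc n)) = ?q n x) sequentially"
        using near by eventually_elim (simp add: f'_def True)
      ultimately have "(\<lambda>n. ?q n x) \<longlonglongrightarrow> gradient f x \<bullet> b"
        by (rule Lim_transform_eventually)
      then show ?thesis
        using True by simp
    next
      case False
      then show ?thesis
        by simp
    qed
  qed measurable
qed

lemma space_past [simp]: "space (past M g t) = space M"
  unfolding past_def by (rule space_measure_of) auto

lemma measurable_past:
  fixes g :: "nat \<Rightarrow> 'w \<Rightarrow> 'a::euclidean_space"
  assumes "s < t"
  shows "g s \<in> borel_measurable (past M g t)"
proof (rule measurableI)
  fix B :: "'a set"
  assume "B \<in> sets borel"
  then show "g s -` B \<inter> space (past M g t) \<in> sets (past M g t)"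
    using assms unfolding space_past unfolding past_def by (subst sets_measure_of) auto
qed simp

lemma subalgebra_past:
  fixes g :: "nat \<Rightarrow> 'w \<Rightarrow> 'a::euclidean_space"
  assumes "\<And>t. g t \<in> borel_measurable M"
  shows "subalgebra M (past M g t)"
  unfolding subalgebra_def
proof
  show "sets (past M g t) \<subseteq> sets M"
    unfolding past_def
    by (subst sets_measure_of) (auto intro!: sets.sigma_sets_subset measurable_sets[OF assms])
qed simp

lemma borel_measurable_sgd:
  fixes g :: "nat \<Rightarrow> 'w \<Rightarrow> 'a::euclidean_space"
  assumes "\<And>s. s < t \<Longrightarrow> g s \<in> borel_measurable N"
  shows "sgd x0 \<eta> g t \<in> borel_measurable N"
  using assms
proof (induction t)
  case 0
  show ?case
    by (simp add: sgd.simps(1)[abs_def])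
next
  case (Suc t)
  then have [measurable]: "sgd x0 \<eta> g t \<in> borel_measurable N" "g t \<in> borel_measurable N"
    by auto
  show ?case
    by (simp add: sgd.simps(2)[abs_def])
qed

lemma borel_measurable_noise:
  fixes g :: "nat \<Rightarrow> 'w \<Rightarrow> 'a::euclidean_space"
  assumes "open X" "f differentiable_on X" and g: "\<And>s. s \<le> t \<Longrightarrow> g s \<in> borel_measurable N"
  shows "noise X f x0 \<eta> g t \<in> borel_measurable N"
proof -
  have [measurable]: "sgd x0 \<eta> g s \<in> borel_measurable N" if "s \<le> t" for s
    using g that by (intro borel_measurable_sgd) auto
  have [measurable]: "X \<in> sets borel" "g t \<in> borel_measurable N"
    using assms by auto
  define gr where "gr = (\<lambda>x. if x \<in> X then gradient f x else 0)"
  have [measurable]: "gr \<in> borel_measurable borel"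
    unfolding gr_def using assms by (intro borel_measurable_gradient)
  have [measurable]: "Measurable.pred N (\<lambda>\<omega>. \<forall>s\<in>{..t}. sgd x0 \<eta> g s \<omega> \<in> X)"
    by (intro pred_intros_finite) auto
  have "noise X f x0 \<eta> g t =
      (\<lambda>\<omega>. if \<forall>s\<in>{..t}. sgd x0 \<eta> g s \<omega> \<in> X then g t \<omega> - gr (sgd x0 \<eta> g t \<omega>) else 0)"
    by (auto simp: fun_eq_iff noise_def gr_def)
  also have "\<dots> \<in> borel_measurable N"
    by measurable
  finally show ?thesis .
qed

text \<open>
  The noise assumption speaks of the conditional second moment as a nonnegative extended real
  function; integrating it against the constant \<open>1\<close> yields the unconditional moment and, with it,
  integrability.
\<close>

lemma (in prob_space) noise_square_integrable:
  assumes "open X" "f differentiable_on X" and na: "noise_assumption M X f x0 \<eta> g \<sigma>"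
  shows "integrable M (\<lambda>\<omega>. (norm (noise X f x0 \<eta> g t \<omega>))\<^sup>2)"
    and "expectation (\<lambda>\<omega>. (norm (noise X f x0 \<eta> g t \<omega>))\<^sup>2) \<le> \<sigma>\<^sup>2"
proof -
  let ?n = "noise X f x0 \<eta> g t" and ?P = "past M g t"
  have g: "g s \<in> borel_measurable M" for s
    using na by (simp add: noise_assumption_def)
  then have [measurable]: "?n \<in> borel_measurable M"
    using assms by (intro borel_measurable_noise)
  interpret P: finite_measure_subalgebra M ?P
    by unfold_locales (rule subalgebra_past[OF g])
  have "(\<integral>\<^sup>+\<omega>. ennreal ((norm (?n \<omega>))\<^sup>2) \<partial>M) =
      (\<integral>\<^sup>+\<omega>. 1 * nn_cond_exp M ?P (\<lambda>\<omega>. ennreal ((norm (?n \<omega>))\<^sup>2)) \<omega> \<partial>M)"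
    by (subst P.nn_cond_exp_intg) auto
  also have "\<dots> \<le> (\<integral>\<^sup>+\<omega>. ennreal (\<sigma>\<^sup>2) \<partial>M)"
    using na by (intro nn_integral_mono_AE) (auto simp: noise_assumption_def)
  also have "\<dots> = ennreal (\<sigma>\<^sup>2)"
    by (simp add: emeasure_space_1)
  finally have le: "(\<integral>\<^sup>+\<omega>. ennreal ((norm (?n \<omega>))\<^sup>2) \<partial>M) \<le> ennreal (\<sigma>\<^sup>2)" .
  show int: "integrable M (\<lambda>\<omega>. (norm (?n \<omega>))\<^sup>2)"
    using le by (intro integrableI_nonneg) (auto simp: less_top[symmetric] top_unique)
  have "ennreal (expectation (\<lambda>\<omega>. (norm (?n \<omega>))\<^sup>2)) \<le> ennreal (\<sigma>\<^sup>2)"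
    using le by (subst nn_integral_eq_integral[OF int, symmetric]) auto
  then show "expectation (\<lambda>\<omega>. (norm (?n \<omega>))\<^sup>2) \<le> \<sigma>\<^sup>2"
    by (simp add: ennreal_le_iff)
qed

text \<open>
  The conditional mean is zero in each coordinate, so each coordinate of the noise is orthogonal to
  every bounded past-measurable function.
\<close>

lemma (in prob_space) noise_orthogonal_to_past:
  fixes Z :: "'a \<Rightarrow> 'b::euclidean_space"
  assumes "open X" "f differentiable_on X" and na: "noise_assumption M X f x0 \<eta> g \<sigma>"
    and Z: "Z \<in> borel_measurable (past M g t)" and bounded: "\<And>\<omega>. norm (Z \<omega>) \<le> B"
  shows "integrable M (\<lambda>\<omega>. Z \<omega> \<bullet> noise X f x0 \<eta> g t \<omega>)"
    and "expectation (\<lambda>\<omega>. Z \<omega> \<bullet> noise X f x0 \<eta> g t \<omega>) = 0"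
proof -
  let ?n = "noise X f x0 \<eta> g t" and ?P = "past M g t"
  have g: "g s \<in> borel_measurable M" for s
    using na by (simp add: noise_assumption_def)
  then have n[measurable]: "?n \<in> borel_measurable M"
    using assms by (intro borel_measurable_noise)
  interpret P: finite_measure_subalgebra M ?P
    by unfold_locales (rule subalgebra_past[OF g])
  have [measurable]: "Z \<in> borel_measurable M"
    using measurable_from_subalg[OF P.subalg Z] .
  have int_n: "integrable M ?n"
  proof (rule Bochner_Integration.integrable_bound)
    show "integrable M (\<lambda>\<omega>. 1 + (norm (?n \<omega>))\<^sup>2)"
      using noise_square_integrable[OF assms(1-3)] by auto
    \<comment> \<open>A square integrable function on a probability space is integrable.\<close>
    have "u \<le> 1 + u\<^sup>2" for u :: real
    proof -
      have "0 \<le> (u - 1)\<^sup>2" "0 \<le> u\<^sup>2"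
        by simp_all
      moreover have "(u - 1)\<^sup>2 = u\<^sup>2 - 2 * u + 1"
        by (simp add: power2_diff)
      ultimately show ?thesis
        by linarith
    qed
    then show "AE \<omega> in M. norm (?n \<omega>) \<le> norm (1 + (norm (?n \<omega>))\<^sup>2)"
      by (auto simp: abs_of_nonneg)
  qed simp
  have int: "integrable M (\<lambda>\<omega>. (Z \<omega> \<bullet> b) * (?n \<omega> \<bullet> b))" if "b \<in> Basis" for b
  proof (rule Bochner_Integration.integrable_bound)
    show "integrable M (\<lambda>\<omega>. B *\<^sub>R ?n \<omega>)"
      using int_n by simp
    show "AE \<omega> in M. norm ((Z \<omega> \<bullet> b) * (?n \<omega> \<bullet> b)) \<le> norm (B *\<^sub>R ?n \<omega>)"
    proof (rule AE_I2)
      fix \<omega>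
      have "\<bar>Z \<omega> \<bullet> b\<bar> \<le> \<bar>B\<bar>" "\<bar>?n \<omega> \<bullet> b\<bar> \<le> norm (?n \<omega>)"
        using Basis_le_norm[OF that, of "Z \<omega>"] Basis_le_norm[OF that, of "?n \<omega>"] bounded[of \<omega>] by auto
      then show "norm ((Z \<omega> \<bullet> b) * (?n \<omega> \<bullet> b)) \<le> norm (B *\<^sub>R ?n \<omega>)"
        by (simp add: abs_mult mult_mono)
    qed
  qed simp
  have zero: "expectation (\<lambda>\<omega>. (Z \<omega> \<bullet> b) * (?n \<omega> \<bullet> b)) = 0" if b: "b \<in> Basis" for b
  proof -
    have Zb: "(\<lambda>\<omega>. Z \<omega> \<bullet> b) \<in> borel_measurable ?P"
      using Z by measurable
    have nb: "(\<lambda>\<omega>. ?n \<omega> \<bullet> b) \<in> borel_measurable M"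
      by measurable
    have "expectation (\<lambda>\<omega>. (Z \<omega> \<bullet> b) * (?n \<omega> \<bullet> b)) =
        expectation (\<lambda>\<omega>. (Z \<omega> \<bullet> b) * real_cond_exp M ?P (\<lambda>\<omega>. ?n \<omega> \<bullet> b) \<omega>)"
      using P.real_cond_exp_intg(2)[OF int[OF b] Zb nb] by simp
    also have "\<dots> = expectation (\<lambda>\<omega>. 0)"
    proof (rule integral_cong_AE)
      show "AE \<omega> in M. (Z \<omega> \<bullet> b) * real_cond_exp M ?P (\<lambda>\<omega>. ?n \<omega> \<bullet> b) \<omega> = 0"
      proof -
        have "AE \<omega> in M. real_cond_exp M ?P (\<lambda>\<omega>. ?n \<omega> \<bullet> b) \<omega> = 0"
          using na b unfolding noise_assumption_def by blast
        then show ?thesis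
          by eventually_elim simp
      qed
    qed auto
    finally show ?thesis
      by simp
  qed
  show "integrable M (\<lambda>\<omega>. Z \<omega> \<bullet> ?n \<omega>)"
    using int by (subst euclidean_inner) auto
  show "expectation (\<lambda>\<omega>. Z \<omega> \<bullet> ?n \<omega>) = 0"
    using int zero by (subst euclidean_inner) (simp add: Bochner_Integration.integral_sum)
qed

section \<open>One step and the stopped energy\<close>

text \<open>
  Both parts of the step, \<open>\<eta> *\<^sub>R gradient f x\<close> and \<open>\<eta> *\<^sub>R n\<close>, have norm at most \<open>G / (2 * l (2 * G))\<close>, so
  the step stays in the ball of the descent inequality. Half of the decrease
  \<open>\<eta> * (norm (gradient f x))\<^sup>2\<close> pays for the quadratic term of the model.
\<close>

lemma sgd_step_descent:
  fixes f :: "'a::euclidean_space \<Rightarrow> real"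
  assumes "open X" and closed: "\<And>a. closed {x \<in> X. f x \<le> a}" and smooth: "ell_smooth_on l X f"
    and l: "mono_on {0..} l" "\<And>u. u \<ge> 0 \<Longrightarrow> l u > 0"
    and "x \<in> X" and grad: "norm (gradient f x) \<le> G" and "0 < G"
    and "0 < \<eta>" and \<eta>: "\<eta> \<le> 1 / (2 * l (2 * G))" and n: "norm n \<le> G / (2 * \<eta> * l (2 * G))"
  shows "x - \<eta> *\<^sub>R (gradient f x + n) \<in> X"
    and "f (x - \<eta> *\<^sub>R (gradient f x + n)) \<le>
      f x - \<eta> / 2 * (norm (gradient f x))\<^sup>2 - \<eta> * (gradient f x \<bullet> n) + l (2 * G) * \<eta>\<^sup>2 * (norm n)\<^sup>2"
proof -
  let ?L = "l (2 * G)" and ?d = "gradient f x"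
  define v where "v = - (\<eta> *\<^sub>R (?d + n))"
  have L: "?L > 0"
    using \<open>0 < G\<close> l(2) by simp
  have "norm v \<le> \<eta> * (norm ?d + norm n)"
    using \<open>0 < \<eta>\<close> by (simp add: v_def norm_triangle_ineq)
  also have "\<dots> \<le> \<eta> * (G + G / (2 * \<eta> * ?L))"
    using grad n \<open>0 < \<eta>\<close> by simp
  also have "\<dots> = \<eta> * G + G / (2 * ?L)"
    using \<open>0 < \<eta>\<close> L by (simp add: field_simps)
  also have "\<eta> * G \<le> 1 / (2 * ?L) * G"
    using \<eta> \<open>0 < G\<close> by (intro mult_right_mono) auto
  finally have "norm v \<le> G / ?L"
    by (simp add: field_simps)
  then have step: "x + v \<in> X" "f (x + v) \<le> f x + ?d \<bullet> v + ?L / 2 * (norm v)\<^sup>2"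
    using descent_in_ball[OF \<open>open X\<close> closed smooth l \<open>x \<in> X\<close> grad \<open>0 < G\<close>] by auto
  have xv: "x + v = x - \<eta> *\<^sub>R (?d + n)"
    by (simp add: v_def)
  show "x - \<eta> *\<^sub>R (?d + n) \<in> X"
    using step xv by simp
  have dv: "?d \<bullet> v = - \<eta> * (norm ?d)\<^sup>2 - \<eta> * (?d \<bullet> n)"
    by (simp add: v_def inner_add_right power2_norm_eq_inner algebra_simps)
  have "(norm (?d + n))\<^sup>2 \<le> 2 * (norm ?d)\<^sup>2 + 2 * (norm n)\<^sup>2"
  proof -
    have "0 \<le> (?d - n) \<bullet> (?d - n)"
      by simp
    then show ?thesis
      by (simp add: power2_norm_eq_inner inner_add_left inner_add_right inner_diff_left
          inner_diff_right inner_commute)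
  qed
  moreover have "(norm v)\<^sup>2 = \<eta>\<^sup>2 * (norm (?d + n))\<^sup>2"
    by (simp add: v_def power_mult_distrib)
  ultimately have "?L / 2 * (norm v)\<^sup>2 \<le> ?L / 2 * (\<eta>\<^sup>2 * (2 * (norm ?d)\<^sup>2 + 2 * (norm n)\<^sup>2))"
    using L by (simp add: mult_left_mono)
  also have "\<dots> = (?L * \<eta>) * (\<eta> * (norm ?d)\<^sup>2) + ?L * \<eta>\<^sup>2 * (norm n)\<^sup>2"
    by (simp add: algebra_simps power2_eq_square)
  also have "(?L * \<eta>) * (\<eta> * (norm ?d)\<^sup>2) \<le> 1 / 2 * (\<eta> * (norm ?d)\<^sup>2)"
    using \<eta> L \<open>0 < \<eta>\<close> by (intro mult_right_mono) (auto simp: field_simps)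
  finally have "f (x + v) \<le> f x - \<eta> / 2 * (norm ?d)\<^sup>2 - \<eta> * (?d \<bullet> n) + ?L * \<eta>\<^sup>2 * (norm n)\<^sup>2"
    using step(2) dv by simp
  then show "f (x - \<eta> *\<^sub>R (?d + n)) \<le>
      f x - \<eta> / 2 * (norm ?d)\<^sup>2 - \<eta> * (?d \<bullet> n) + ?L * \<eta>\<^sup>2 * (norm n)\<^sup>2"
    using xv by simp
qed

text \<open>
  The bookkeeping of the stopping time \<open>m\<close>, the first \<open>t < n\<close> at which \<open>good t\<close> fails, or \<open>n\<close> if
  there is none. The potential at the stopping time plus the dissipation \<open>a\<close> so far is bounded by a sum over the fixed range \<open>t < n\<close>, in
  which only the steps taken before \<open>m\<close> contribute. The predicate \<open>D\<close> (being in the domain) survives the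
  last good step, so that the potential makes sense at time \<open>m\<close>.
\<close>

lemma stopped_energy:
  fixes \<phi> a y :: "nat \<Rightarrow> real"
  assumes "D 0" and mono: "\<And>t. good (Suc t) \<Longrightarrow> good t"
    and step: "\<And>t. good t \<Longrightarrow> D (Suc t) \<and> \<phi> (Suc t) + a t \<le> \<phi> t + y t"
  obtains m where "m \<le> n" "\<And>t. t < m \<Longrightarrow> good t" "D m" "m = n \<or> \<not> good m"
    "\<phi> m + (\<Sum>t<m. a t) \<le> \<phi> 0 + (\<Sum>t<n. if good t then y t else 0)"
proof -
  have anti: "good s" if "good t" "s \<le> t" for s t
    using that(2,1) by (induction rule: dec_induct) (auto dest: mono)
  have "\<exists>m\<le>n. (\<forall>t<m. good t) \<and> D m \<and> (m = n \<or> \<not> good m) \<and>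
      \<phi> m + (\<Sum>t<m. a t) \<le> \<phi> 0 + (\<Sum>t<n. if good t then y t else 0)"
  proof (induction n)
    case 0
    show ?case
      using \<open>D 0\<close> by simp
  next
    case (Suc n)
    then obtain m where m: "m \<le> n" "\<forall>t<m. good t" "D m" "m = n \<or> \<not> good m"
      and le: "\<phi> m + (\<Sum>t<m. a t) \<le> \<phi> 0 + (\<Sum>t<n. if good t then y t else 0)"
      by blast
    show ?case
    proof (cases "good n")
      case True
      then have "m = n"
        using m anti by blast
      moreover have "\<forall>t<Suc n. good t"
        using True anti less_Suc_eq_le by blast
      ultimately show ?thesis
        using step[OF True] le True by (intro exI[of _ "Suc n"]) auto
    next
      case False
      then have "\<not> good m"
        using m(4) by blast
      then show ?thesis
        using False m le by (intro exI[of _ m]) auto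
    qed
  qed
  then show thesis
    using that by blast
qed

section \<open>The gradient bound determined by the level F\<close>

text \<open>
  Subquadratic growth gives \<open>l (2 * u) < 4 * u\<^sup>2 / (8 * F + 1)\<close> for large \<open>u\<close>, which is incompatible with
  \<open>u\<^sup>2 \<le> 2 * l (2 * u) * F\<close>.
\<close>

lemma bdd_above_gradient_levels:
  assumes "subquadratic l" and "0 \<le> F"
  shows "bdd_above {u::real. u \<ge> 0 \<and> u\<^sup>2 \<le> 2 * l (2 * u) * F}"
proof -
  have "eventually (\<lambda>u. l u / u\<^sup>2 < 1 / (8 * F + 1)) at_top"
    using assms unfolding subquadratic_def by (intro order_tendstoD) auto
  then obtain U where U: "\<And>u. u \<ge> U \<Longrightarrow> l u / u\<^sup>2 < 1 / (8 * F + 1)"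
    by (auto simp: eventually_at_top_linorder)
  have "u \<le> max 1 U" if u: "u \<ge> 0" "u\<^sup>2 \<le> 2 * l (2 * u) * F" for u
  proof (rule ccontr)
    assume "\<not> u \<le> max 1 U"
    then have big: "1 < u" "U \<le> 2 * u"
      by auto
    have "l (2 * u) < 4 * u\<^sup>2 / (8 * F + 1)"
      using U[OF big(2)] big(1) by (simp add: field_simps power_mult_distrib)
    then have "2 * l (2 * u) * F \<le> 2 * (4 * u\<^sup>2 / (8 * F + 1)) * F"
      using \<open>0 \<le> F\<close> by (intro mult_right_mono mult_left_mono) auto
    also have "\<dots> < u\<^sup>2"
      using big(1) \<open>0 \<le> F\<close> by (simp add: field_simps)
    finally show False
      using u(2) by simp
  qed
  then show ?thesis
    by (intro bdd_aboveI) auto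
qed

text \<open>
  If \<open>G\<^sup>2 < 2 * l (2 * G) * F\<close>, then the square root \<open>u\<close> of the right-hand side would be a larger member of
  the set, because \<open>l\<close> is nondecreasing.
\<close>

lemma Sup_gradient_levels_pos:
  assumes l: "mono_on {0..} l" "\<And>u. u \<ge> 0 \<Longrightarrow> l u > 0" and "0 < F"
    and bdd: "bdd_above {u::real. u \<ge> 0 \<and> u\<^sup>2 \<le> 2 * l (2 * u) * F}"
    and G: "G = Sup {u. u \<ge> 0 \<and> u\<^sup>2 \<le> 2 * l (2 * u) * F}"
  shows "0 < G" and "2 * l (2 * G) * F \<le> G\<^sup>2"
proof -
  have upper: "u \<le> G" if "u \<ge> 0" "u\<^sup>2 \<le> 2 * l (2 * u) * F" for u
    unfolding G using that bdd by (intro cSup_upper) auto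
  have "0 \<le> G"
    using upper[of 0] l(2)[of 0] \<open>0 < F\<close> by simp
  show ge: "2 * l (2 * G) * F \<le> G\<^sup>2"
  proof (rule ccontr)
    assume less: "\<not> 2 * l (2 * G) * F \<le> G\<^sup>2"
    define u where "u = sqrt (2 * l (2 * G) * F)"
    have pos: "2 * l (2 * G) * F > 0"
      using l(2)[of "2 * G"] \<open>0 \<le> G\<close> \<open>0 < F\<close> by simp
    then have u: "u\<^sup>2 = 2 * l (2 * G) * F" "u \<ge> 0"
      by (auto simp: u_def)
    from u(1) less have "G\<^sup>2 < u\<^sup>2"
      by linarith
    then have "G < u"
      using u(2) by (rule power2_less_imp_less)
    then have "l (2 * G) \<le> l (2 * u)"
      using \<open>0 \<le> G\<close> by (intro mono_onD[OF l(1)]) auto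
    then have "u\<^sup>2 \<le> 2 * l (2 * u) * F"
      using u \<open>0 < F\<close> by simp
    then show False
      using upper[OF u(2)] \<open>G < u\<close> by simp
  qed
  have "2 * l (2 * G) * F > 0"
    using l(2)[of "2 * G"] \<open>0 \<le> G\<close> \<open>0 < F\<close> by simp
  then have "G \<noteq> 0"
    using ge by auto
  then show "0 < G"
    using \<open>0 \<le> G\<close> by simp
qed

section \<open>The high-probability bound\<close>

text \<open>
  The probability of a set that is not measurable would be zero, so this is part of the claim. On the
  event all iterates are in \<open>X\<close>, so the gradient can be cut off to \<open>X\<close>, where it is measurable.
\<close>

lemma sgd_event_measurable:
  fixes f :: "'a::euclidean_space \<Rightarrow> real"
  assumes "open X" "f differentiable_on X" and g: "\<And>t. g t \<in> borel_measurable M"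
  shows "{\<omega> \<in> space M.
      (\<forall>t<T. sgd x0 \<eta> g t \<omega> \<in> X \<and> norm (gradient f (sgd x0 \<eta> g t \<omega>)) \<le> G) \<and>
      (\<Sum>t<T. (norm (gradient f (sgd x0 \<eta> g t \<omega>)))\<^sup>2) \<le> c} \<in> sets M" (is "?E \<in> _")
proof -
  define gr where "gr = (\<lambda>x. if x \<in> X then gradient f x else 0)"
  have [measurable]: "gr \<in> borel_measurable borel"
    unfolding gr_def using assms(1,2) by (rule borel_measurable_gradient)
  have [measurable]: "sgd x0 \<eta> g t \<in> borel_measurable M" for t
    by (rule borel_measurable_sgd[OF g])
  have [measurable]: "X \<in> sets borel"
    using \<open>open X\<close> by simp
  have "?E = {\<omega> \<in> space M.
      (\<forall>t\<in>{..<T}. sgd x0 \<eta> g t \<omega> \<in> X \<and> norm (gr (sgd x0 \<eta> g t \<omega>)) \<le> G) \<and>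
      (\<Sum>t<T. (norm (gr (sgd x0 \<eta> g t \<omega>)))\<^sup>2) \<le> c}"
    by (auto simp: gr_def)
  also have "\<dots> \<in> sets M"
    by measurable
  finally show ?thesis .
qed

text \<open>
  The argument for \<open>F > 0\<close>. The event \<open>A t\<close> is that all iterates up to time \<open>t\<close> are in the sublevel set
  \<open>S\<close> and all noise vectors before time \<open>t\<close> have norm at most \<open>K\<close>; it belongs to the past of \<open>t\<close>.
  Step \<open>t\<close> is taken on the smaller event \<open>stay t\<close>, where in addition the noise at time \<open>t\<close> is small. The
  random variable \<open>R\<close> dominates the stopped energy of every path, and since it uses \<open>A t\<close> instead of
  \<open>stay t\<close>, its inner products have mean zero.
\<close>

lemma (in prob_space) sgd_high_probability:
  fixes f :: "'b::euclidean_space \<Rightarrow> real" and g :: "nat \<Rightarrow> 'a \<Rightarrow> 'b"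
  assumes "open X" and closed: "\<And>a. closed {x \<in> X. f x \<le> a}" and smooth: "ell_smooth_on l X f"
    and l: "mono_on {0..} l" "\<And>u. u \<ge> 0 \<Longrightarrow> l u > 0"
    and "x0 \<in> X" and lower: "\<And>x. x \<in> X \<Longrightarrow> fmin \<le> f x"
    and "0 \<le> \<sigma>" and na: "noise_assumption M X f x0 \<eta> g \<sigma>"
    and \<delta>: "0 < \<delta>" "\<delta> < 1"
    and F: "F = 8 * (f x0 - fmin + \<sigma>) / \<delta>" "0 < F"
    and G: "0 < G" "2 * l (2 * G) * F \<le> G\<^sup>2"
    and level: "\<And>u. u \<ge> 0 \<Longrightarrow> u\<^sup>2 \<le> 2 * l (2 * u) * F \<Longrightarrow> u \<le> G"
    and "0 < \<eta>" and \<eta>: "\<eta> \<le> 1 / (2 * l (2 * G))" "\<eta> \<le> 1 / (4 * G * sqrt (real T))"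
    and "0 < T"
  shows "1 - \<delta> \<le> prob {\<omega> \<in> space M.
      (\<forall>t<T. sgd x0 \<eta> g t \<omega> \<in> X \<and> norm (gradient f (sgd x0 \<eta> g t \<omega>)) \<le> G) \<and>
      (\<Sum>t<T. (norm (gradient f (sgd x0 \<eta> g t \<omega>)))\<^sup>2) \<le> F / \<eta>}"
    (is "_ \<le> prob ?good")
proof -
  define L where "L = l (2 * G)"
  \<comment> \<open>With noise at most \<open>K\<close>, a step from a point with gradient norm at most \<open>G\<close> has length at most \<open>G / L\<close>.\<close>
  define K where "K = G / (2 * \<eta> * L)"
  define \<Delta> where "\<Delta> = f x0 - fmin"
  let ?x = "sgd x0 \<eta> g" and ?n = "noise X f x0 \<eta> g"
  have L: "0 < L"
    using l(2) G(1) by (simp add: L_def)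
  have K: "0 < K"
    using L G(1) \<open>0 < \<eta>\<close> by (simp add: K_def)
  have \<Delta>: "0 \<le> \<Delta>"
    using lower[OF \<open>x0 \<in> X\<close>] by (simp add: \<Delta>_def)
  have F\<delta>: "F * \<delta> = 8 * (\<Delta> + \<sigma>)"
    using F(1) \<delta>(1) by (simp add: \<Delta>_def)
  have diff: "f differentiable_on X"
    using smooth by (simp add: ell_smooth_on_def)
  define gr where "gr = (\<lambda>x. if x \<in> X then gradient f x else 0)"
  have gr[measurable]: "gr \<in> borel_measurable borel"
    unfolding gr_def by (rule borel_measurable_gradient[OF \<open>open X\<close> diff])
  have g[measurable]: "g t \<in> borel_measurable M" for t
    using na by (simp add: noise_assumption_def)
  have x_meas[measurable]: "?x t \<in> borel_measurable M" for t
    by (rule borel_measurable_sgd[OF g])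
  have n_meas[measurable]: "?n t \<in> borel_measurable M" for t
    by (rule borel_measurable_noise[OF \<open>open X\<close> diff g])
  have X[measurable]: "X \<in> sets borel"
    using \<open>open X\<close> by simp

  define S where "S = {x \<in> X. f x \<le> fmin + F}"
  have S[measurable]: "S \<in> sets borel"
    unfolding S_def using closed by (rule borel_closed)
  have grad_S: "norm (gradient f x) \<le> G" if "x \<in> S" for x
  proof (rule level)
    have "x \<in> X" and "f x - fmin \<le> F"
      using that by (auto simp: S_def)
    have "(norm (gradient f x))\<^sup>2 \<le> 2 * l (2 * norm (gradient f x)) * (f x - fmin)"
      by (rule gradient_norm_bound[OF \<open>open X\<close> closed smooth l \<open>x \<in> X\<close> lower])
    also have "\<dots> \<le> 2 * l (2 * norm (gradient f x)) * F"
      using \<open>f x - fmin \<le> F\<close> l(2)[of "2 * norm (gradient f x)"] by (intro mult_left_mono) auto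
    finally show "(norm (gradient f x))\<^sup>2 \<le> 2 * l (2 * norm (gradient f x)) * F" .
  qed simp

  define A where "A = (\<lambda>t \<omega>. (\<forall>s\<in>{..t}. ?x s \<omega> \<in> S) \<and> (\<forall>s\<in>{..<t}. norm (?n s \<omega>) \<le> K))"
  \<comment> \<open>Cutting off to \<open>A t\<close> makes the gradient bounded and keeps it past-measurable.\<close>
  define Z where "Z = (\<lambda>t \<omega>. if A t \<omega> then gr (?x t \<omega>) else 0)"
  have Z_bound: "norm (Z t \<omega>) \<le> G" for t \<omega>
    using grad_S[of "?x t \<omega>"] G(1) by (auto simp: Z_def A_def gr_def)
  have Z_past: "Z t \<in> borel_measurable (past M g t)" for t
  proof -
    have [measurable]: "?x s \<in> borel_measurable (past M g t)" if "s \<le> t" for s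
      using that by (intro borel_measurable_sgd measurable_past) auto
    have [measurable]: "?n s \<in> borel_measurable (past M g t)" if "s < t" for s
      using that by (intro borel_measurable_noise[OF \<open>open X\<close> diff] measurable_past) auto
    have [measurable]: "Measurable.pred (past M g t) (A t)"
      unfolding A_def by (intro pred_intros_logic pred_intros_finite) auto
    show ?thesis
      unfolding Z_def by measurable
  qed
  note n_sq = noise_square_integrable[OF \<open>open X\<close> diff na]
  note Z_n = noise_orthogonal_to_past[OF \<open>open X\<close> diff na Z_past Z_bound]
  define R where "R = (\<lambda>\<omega>. \<Delta> + (\<Sum>t<T. 3 * L * \<eta>\<^sup>2 * (norm (?n t \<omega>))\<^sup>2 - \<eta> * (Z t \<omega> \<bullet> ?n t \<omega>)))"
  have R_int: "integrable M R"
    unfolding R_def using n_sq(1) Z_n(1) by auto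
  have R_exp: "expectation R \<le> \<Delta> + real T * (3 * L * \<eta>\<^sup>2 * \<sigma>\<^sup>2)"
  proof -
    have "expectation R = \<Delta> + (\<Sum>t<T. 3 * L * \<eta>\<^sup>2 * expectation (\<lambda>\<omega>. (norm (?n t \<omega>))\<^sup>2))"
      unfolding R_def using n_sq(1) Z_n by (simp add: prob_space)
    also have "(\<Sum>t<T. 3 * L * \<eta>\<^sup>2 * expectation (\<lambda>\<omega>. (norm (?n t \<omega>))\<^sup>2)) \<le> (\<Sum>t<T. 3 * L * \<eta>\<^sup>2 * \<sigma>\<^sup>2)"
      using n_sq(2) L by (intro sum_mono mult_left_mono) auto
    finally show ?thesis
      by simp
  qed

  have path: "\<exists>m\<le>T. (\<forall>t<m. A t \<omega> \<and> norm (?n t \<omega>) \<le> K) \<and> ?x m \<omega> \<in> X \<and>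
      (m = T \<or> \<not> (A m \<omega> \<and> norm (?n m \<omega>) \<le> K)) \<and>
      f (?x m \<omega>) - fmin + (\<Sum>t<m. \<eta> / 2 * (norm (gradient f (?x t \<omega>)))\<^sup>2) \<le> R \<omega>" for \<omega>
  proof -
    define stay where "stay = (\<lambda>t. A t \<omega> \<and> norm (?n t \<omega>) \<le> K)"
    define y where "y = (\<lambda>t. L * \<eta>\<^sup>2 * (norm (?n t \<omega>))\<^sup>2 - \<eta> * (gradient f (?x t \<omega>) \<bullet> ?n t \<omega>))"
    have stay_mono: "stay t" if "stay (Suc t)" for t
      using that by (auto simp: stay_def A_def)
    have x0: "?x 0 \<omega> \<in> X"
      using \<open>x0 \<in> X\<close> by simp
    have descent: "?x (Suc t) \<omega> \<in> X \<and>
        f (?x (Suc t) \<omega>) - fmin + \<eta> / 2 * (norm (gradient f (?x t \<omega>)))\<^sup>2 \<le> f (?x t \<omega>) - fmin + y t"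
      if "stay t" for t
    proof -
      let ?d = "gradient f (?x t \<omega>)"
      have inS: "?x t \<omega> \<in> S" and inX: "\<forall>s\<le>t. ?x s \<omega> \<in> X" and n: "norm (?n t \<omega>) \<le> K"
        using that by (auto simp: stay_def A_def S_def)
      have "?n t \<omega> = g t \<omega> - ?d"
        using inX by (simp add: noise_def)
      then have next_x: "?x (Suc t) \<omega> = ?x t \<omega> - \<eta> *\<^sub>R (?d + ?n t \<omega>)"
        by simp
      have "?x t \<omega> \<in> X"
        using inX by simp
      from sgd_step_descent[OF \<open>open X\<close> closed smooth l this grad_S[OF inS] G(1) \<open>0 < \<eta>\<close> \<eta>(1),
          of "?n t \<omega>"] n
      show ?thesis
        unfolding next_x y_def by (auto simp: K_def L_def)
    qed
    obtain m where m: "m \<le> T" "\<And>t. t < m \<Longrightarrow> stay t" "?x m \<omega> \<in> X" "m = T \<or> \<not> stay m"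
      "f (?x m \<omega>) - fmin + (\<Sum>t<m. \<eta> / 2 * (norm (gradient f (?x t \<omega>)))\<^sup>2)
        \<le> f (?x 0 \<omega>) - fmin + (\<Sum>t<T. if stay t then y t else 0)"
      using stopped_energy[where D = "\<lambda>t. ?x t \<omega> \<in> X" and good = stay
          and \<phi> = "\<lambda>t. f (?x t \<omega>) - fmin" and a = "\<lambda>t. \<eta> / 2 * (norm (gradient f (?x t \<omega>)))\<^sup>2"
          and y = y and n = T, OF x0 stay_mono descent] by blast
    have "(if stay t then y t else 0) \<le> 3 * L * \<eta>\<^sup>2 * (norm (?n t \<omega>))\<^sup>2 - \<eta> * (Z t \<omega> \<bullet> ?n t \<omega>)" for t
    proof -
      have nn: "0 \<le> L * \<eta>\<^sup>2 * (norm (?n t \<omega>))\<^sup>2"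
        using L by simp
      consider "stay t" | "\<not> A t \<omega>" | "A t \<omega>" "K < norm (?n t \<omega>)"
        by (force simp: stay_def)
      then show ?thesis
      proof cases
        case 1
        then have "Z t \<omega> = gradient f (?x t \<omega>)"
          by (auto simp: stay_def Z_def gr_def A_def S_def)
        then show ?thesis
          using 1 nn by (simp add: y_def)
      next
        case 2
        then show ?thesis
          using nn by (simp add: Z_def stay_def)
      next
        case 3
        \<comment> \<open>No step is taken, but \<open>Z t\<close> does not know this yet; the noise is so large that its square pays for the inner product.\<close>
        then have "G \<le> 2 * \<eta> * L * norm (?n t \<omega>)"
          using L \<open>0 < \<eta>\<close> by (simp add: K_def field_simps)
        then have "norm (Z t \<omega>) \<le> 2 * \<eta> * L * norm (?n t \<omega>)"
          using Z_bound[of t \<omega>] by linarith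
        then have "Z t \<omega> \<bullet> ?n t \<omega> \<le> 2 * \<eta> * L * norm (?n t \<omega>) * norm (?n t \<omega>)"
          by (intro order_trans[OF norm_cauchy_schwarz] mult_right_mono) auto
        then have "\<eta> * (Z t \<omega> \<bullet> ?n t \<omega>) \<le> \<eta> * (2 * \<eta> * L * norm (?n t \<omega>) * norm (?n t \<omega>))"
          using \<open>0 < \<eta>\<close> by (intro mult_left_mono) auto
        also have "\<dots> = 2 * (L * \<eta>\<^sup>2 * (norm (?n t \<omega>))\<^sup>2)"
          by (simp add: power2_eq_square)
        finally show ?thesis
          using 3 nn by (simp add: stay_def)
      qed
    qed
    then have "f (?x 0 \<omega>) - fmin + (\<Sum>t<T. if stay t then y t else 0) \<le> R \<omega>"
      unfolding R_def \<Delta>_def by (auto intro!: sum_mono)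
    then show ?thesis
      using m unfolding stay_def by (intro exI[of _ m]) auto
  qed
  have R_nonneg: "0 \<le> R \<omega>" for \<omega>
  proof -
    obtain m where "?x m \<omega> \<in> X"
      "f (?x m \<omega>) - fmin + (\<Sum>t<m. \<eta> / 2 * (norm (gradient f (?x t \<omega>)))\<^sup>2) \<le> R \<omega>"
      using path by blast
    moreover have "0 \<le> (\<Sum>t<m. \<eta> / 2 * (norm (gradient f (?x t \<omega>)))\<^sup>2)"
      using \<open>0 < \<eta>\<close> by (intro sum_nonneg) auto
    ultimately show ?thesis
      using lower[of "?x m \<omega>"] by linarith
  qed

  let ?bad = "{\<omega> \<in> space M. F / 2 \<le> R \<omega>} \<union> (\<Union>t\<in>{..<T}. {\<omega> \<in> space M. K\<^sup>2 \<le> (norm (?n t \<omega>))\<^sup>2})"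
  have good_path: "\<omega> \<in> ?good" if \<omega>: "\<omega> \<in> space M - ?bad" for \<omega>
  proof -
    have R: "R \<omega> < F / 2"
      using \<omega> by auto
    have n: "norm (?n t \<omega>) \<le> K" if "t < T" for t
    proof -
      have "(norm (?n t \<omega>))\<^sup>2 < K\<^sup>2"
        using \<omega> that by (auto simp: not_le)
      then have "norm (?n t \<omega>) < K"
        by (rule power2_less_imp_less) (use K in simp)
      then show ?thesis
        by simp
    qed
    obtain m where m: "m \<le> T" "\<forall>t<m. A t \<omega> \<and> norm (?n t \<omega>) \<le> K" "?x m \<omega> \<in> X"
      "m = T \<or> \<not> (A m \<omega> \<and> norm (?n m \<omega>) \<le> K)"
      and energy: "f (?x m \<omega>) - fmin + (\<Sum>t<m. \<eta> / 2 * (norm (gradient f (?x t \<omega>)))\<^sup>2) \<le> R \<omega>"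
      using path by blast
    have sum0: "0 \<le> (\<Sum>t<m. \<eta> / 2 * (norm (gradient f (?x t \<omega>)))\<^sup>2)"
      using \<open>0 < \<eta>\<close> by (intro sum_nonneg) auto
    have in_S: "?x t \<omega> \<in> S" if "t < m" for t
      using m(2) that by (auto simp: A_def)
    have "m = T"
    proof (rule ccontr)
      assume "m \<noteq> T"
      then have "\<not> A m \<omega>"
        using m(1,4) n by auto
      \<comment> \<open>With bounded noise the process can stop early only by leaving the sublevel set, but then the energy already exceeds \<open>F\<close>.\<close>
      then have "?x m \<omega> \<notin> S"
        using m(2) in_S by (force simp: A_def le_less)
      then have "F < f (?x m \<omega>) - fmin"
        using m(3) by (simp add: S_def)
      then show False
        using energy sum0 R F(2) by linarith
    qed
    have "\<eta> / 2 * (\<Sum>t<T. (norm (gradient f (?x t \<omega>)))\<^sup>2) \<le> F / 2"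
      using energy R lower[OF m(3)] unfolding \<open>m = T\<close> sum_distrib_left by linarith
    then have "(\<Sum>t<T. (norm (gradient f (?x t \<omega>)))\<^sup>2) \<le> F / \<eta>"
      using \<open>0 < \<eta>\<close> by (simp add: field_simps)
    moreover have "?x t \<omega> \<in> X \<and> norm (gradient f (?x t \<omega>)) \<le> G" if "t < T" for t
      using in_S[of t] grad_S[of "?x t \<omega>"] that \<open>m = T\<close> by (auto simp: S_def)
    ultimately show ?thesis
      using \<omega> by auto
  qed

  have T\<eta>: "real T * \<eta>\<^sup>2 \<le> 1 / (16 * G\<^sup>2)"
  proof -
    have "\<eta>\<^sup>2 \<le> (1 / (4 * G * sqrt (real T)))\<^sup>2"
      using \<eta>(2) \<open>0 < \<eta>\<close> by (intro power_mono) auto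
    also have "\<dots> = 1 / (16 * G\<^sup>2 * real T)"
      by (simp add: power_divide power_mult_distrib)
    finally show ?thesis
      using \<open>0 < T\<close> G(1) by (simp add: field_simps)
  qed
  \<comment> \<open>The error terms are multiples of \<open>T * \<eta>\<^sup>2 * L * \<sigma>\<^sup>2\<close> and \<open>T * \<eta>\<^sup>2 * L\<^sup>2 * \<sigma>\<^sup>2 / G\<^sup>2\<close>; the preceding bound
      turns the factors before \<open>\<sigma>\<^sup>2\<close> into powers of \<open>L / G\<^sup>2\<close>.\<close>
  have LG: "L / G\<^sup>2 \<le> 1 / (2 * F)"
    using G F(2) by (simp add: L_def field_simps)
  have \<sigma>F: "8 * \<sigma> \<le> F * \<delta>"
    using F\<delta> \<Delta> by simp
  have prob_R: "prob {\<omega> \<in> space M. F / 2 \<le> R \<omega>} \<le> \<delta> / 4"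
  proof -
    have "real T * (3 * L * \<eta>\<^sup>2 * \<sigma>\<^sup>2) = (real T * \<eta>\<^sup>2) * (3 * L * \<sigma>\<^sup>2)"
      by simp
    also have "\<dots> \<le> 1 / (16 * G\<^sup>2) * (3 * L * \<sigma>\<^sup>2)"
      using T\<eta> L by (intro mult_right_mono) auto
    also have "\<dots> = (L / G\<^sup>2) * (3 / 16 * \<sigma>\<^sup>2)"
      by simp
    also have "\<dots> \<le> 1 / (2 * F) * (3 / 16 * \<sigma>\<^sup>2)"
      using LG by (intro mult_right_mono) auto
    also have "\<dots> \<le> \<sigma>"
    proof -
      have "8 * \<sigma> \<le> F"
        using \<sigma>F \<delta> F(2) mult_left_le[of \<delta> F] by linarith
      then have "\<sigma> * (8 * \<sigma>) \<le> \<sigma> * F"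
        using \<open>0 \<le> \<sigma>\<close> by (rule mult_left_mono)
      moreover have "0 \<le> \<sigma> * F"
        using \<open>0 \<le> \<sigma>\<close> F(2) by simp
      ultimately show ?thesis
        using F(2) by (simp add: field_simps power2_eq_square)
    qed
    finally have "expectation R \<le> F * \<delta> / 8"
      using R_exp F\<delta> by simp
    then have "expectation R / (F / 2) \<le> (F * \<delta> / 8) / (F / 2)"
      using F(2) by (intro divide_right_mono) auto
    moreover have "prob {\<omega> \<in> space M. F / 2 \<le> R \<omega>} \<le> expectation R / (F / 2)"
      using R_int R_nonneg F(2) by (intro integral_Markov_inequality_measure[where A = "{}"]) auto
    ultimately show ?thesis
      using F(2) by simp
  qed
  have prob_n: "prob (\<Union>t\<in>{..<T}. {\<omega> \<in> space M. K\<^sup>2 \<le> (norm (?n t \<omega>))\<^sup>2}) \<le> \<delta> / 4"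
  proof -
    have each: "prob {\<omega> \<in> space M. K\<^sup>2 \<le> (norm (?n t \<omega>))\<^sup>2} \<le> \<sigma>\<^sup>2 / K\<^sup>2" for t
    proof -
      have "prob {\<omega> \<in> space M. K\<^sup>2 \<le> (norm (?n t \<omega>))\<^sup>2} \<le>
          expectation (\<lambda>\<omega>. (norm (?n t \<omega>))\<^sup>2) / K\<^sup>2"
        using n_sq(1) K by (intro integral_Markov_inequality_measure[where A = "{}"]) auto
      also have "\<dots> \<le> \<sigma>\<^sup>2 / K\<^sup>2"
        using n_sq(2) by (intro divide_right_mono) auto
      finally show ?thesis .
    qed
    have "prob (\<Union>t\<in>{..<T}. {\<omega> \<in> space M. K\<^sup>2 \<le> (norm (?n t \<omega>))\<^sup>2}) \<le>
        (\<Sum>t<T. prob {\<omega> \<in> space M. K\<^sup>2 \<le> (norm (?n t \<omega>))\<^sup>2})"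
      by (intro finite_measure_subadditive_finite) auto
    also have "\<dots> \<le> (\<Sum>t<T. \<sigma>\<^sup>2 / K\<^sup>2)"
      by (intro sum_mono each)
    also have "\<dots> = (real T * \<eta>\<^sup>2) * (4 * L\<^sup>2 * \<sigma>\<^sup>2 / G\<^sup>2)"
      by (simp add: K_def power_divide power_mult_distrib)
    also have "\<dots> \<le> 1 / (16 * G\<^sup>2) * (4 * L\<^sup>2 * \<sigma>\<^sup>2 / G\<^sup>2)"
      using T\<eta> by (intro mult_right_mono) auto
    also have "\<dots> = (L / G\<^sup>2)\<^sup>2 * (\<sigma>\<^sup>2 / 4)"
      by (simp add: power_divide power2_eq_square)
    also have "\<dots> \<le> (1 / (2 * F))\<^sup>2 * (\<sigma>\<^sup>2 / 4)"
      using LG L by (intro mult_right_mono power_mono) auto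
    also have "\<dots> = (\<sigma> / F)\<^sup>2 / 16"
      by (simp add: power_divide power_mult_distrib)
    also have "\<dots> \<le> \<delta>\<^sup>2 / 16"
    proof -
      have "\<sigma> / F \<le> \<delta>"
        using \<sigma>F F(2) \<open>0 \<le> \<sigma>\<close> by (simp add: field_simps)
      then show ?thesis
        using \<open>0 \<le> \<sigma>\<close> F(2) by (intro divide_right_mono power_mono) auto
    qed
    also have "\<dots> \<le> \<delta> / 4"
      using \<delta> mult_left_le[of \<delta> \<delta>] by (simp add: power2_eq_square)
    finally show ?thesis .
  qed

  have good_sets: "?good \<in> events"
    by (rule sgd_event_measurable[OF \<open>open X\<close> diff g])
  have R_meas[measurable]: "R \<in> borel_measurable M"
    using R_int by auto
  have bad_sets: "?bad \<in> events"
    by measurable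
  have "prob ?bad \<le> \<delta> / 4 + \<delta> / 4"
    using prob_R prob_n by (intro order_trans[OF measure_Un_le] add_mono) auto
  then have "1 - \<delta> \<le> 1 - prob ?bad"
    using \<delta>(1) by simp
  also have "\<dots> = prob (space M - ?bad)"
    using prob_compl[OF bad_sets] by simp
  also have "\<dots> \<le> prob ?good"
    using good_path good_sets by (intro finite_measure_mono) blast+
  finally show ?thesis .
qed

text \<open>
  The degenerate case of the theorem, in which \<open>G = 0\<close> and the step size is not limited by the horizon.
\<close>

lemma (in prob_space) sgd_constant_if_noiseless_at_critical_point:
  fixes f :: "'b::euclidean_space \<Rightarrow> real" and g :: "nat \<Rightarrow> 'a \<Rightarrow> 'b"
  assumes "open X" and diff: "f differentiable_on X" and "x0 \<in> X" and crit: "gradient f x0 = 0"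
    and na: "noise_assumption M X f x0 \<eta> g 0"
  shows "AE \<omega> in M. \<forall>t. sgd x0 \<eta> g t \<omega> = x0"
proof -
  let ?n = "noise X f x0 \<eta> g"
  note n_sq = noise_square_integrable[OF \<open>open X\<close> diff na]
  have "AE \<omega> in M. ?n t \<omega> = 0" for t
  proof -
    have "expectation (\<lambda>\<omega>. (norm (?n t \<omega>))\<^sup>2) = 0"
      using n_sq(2)[of t] by (intro antisym integral_nonneg_AE) auto
    then have "AE \<omega> in M. (norm (?n t \<omega>))\<^sup>2 = 0"
      using integral_nonneg_eq_0_iff_AE[OF n_sq(1)] by auto
    then show ?thesis
      by simp
  qed
  then have "AE \<omega> in M. \<forall>t. ?n t \<omega> = 0"
    by (simp add: AE_all_countable)
  then show ?thesis
  proof eventually_elim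
    case (elim \<omega>)
    show ?case
    proof
      fix t
      show "sgd x0 \<eta> g t \<omega> = x0"
      proof (induction t rule: less_induct)
        case (less t)
        show ?case
        proof (cases t)
          case (Suc s)
          have x: "sgd x0 \<eta> g r \<omega> = x0" if "r \<le> s" for r
            using less Suc that by simp
          then have "?n s \<omega> = g s \<omega>"
            using \<open>x0 \<in> X\<close> crit by (simp add: noise_def)
          then show ?thesis
            using elim x[of s] Suc by simp
        qed simp
      qed
    qed
  qed
qed

theorem theorem5p3:
  fixes X :: "(real ^ 'd) set"
    and f :: "real ^ 'd \<Rightarrow> real"
    and l :: "real \<Rightarrow> real"
    and M :: "'w measure"
    and g :: "nat \<Rightarrow> 'w \<Rightarrow> real ^ 'd"
    and x0 :: "real ^ 'd"
    and \<sigma> \<delta> \<eta> \<epsilon> F G L :: real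
    and T :: nat
  assumes "open X"
    and "\<And>a. closed {x \<in> X. f x \<le> a}"
    and "bdd_below (f ` X)"
    and "continuous_on {0..} l" and "mono_on {0..} l" and "\<And>u. u \<ge> 0 \<Longrightarrow> l u > 0"
    and "ell_smooth_on l X f"
    and "subquadratic l"
    and "x0 \<in> X"
    and "prob_space M"
    and "\<sigma> \<ge> 0" and "noise_assumption M X f x0 \<eta> g \<sigma>"
    and "0 < \<delta>" and "\<delta> < 1"
    and F: "F = 8 * (f x0 - (INF x\<in>X. f x) + \<sigma>) / \<delta>"
    and G: "G = Sup {u. u \<ge> 0 \<and> u\<^sup>2 \<le> 2 * l (2 * u) * F}"
    and L: "L = l (2 * G)"
    and "\<epsilon> > 0" and "\<eta> > 0" and "T \<ge> 1"
    and "\<eta> \<le> 1 / (2 * L)"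
    and "G \<noteq> 0 \<Longrightarrow> \<eta> \<le> 1 / (4 * G * sqrt (real T))"
    and "real T \<ge> F / (\<eta> * \<epsilon>\<^sup>2)"
  shows "bdd_above {u. u \<ge> 0 \<and> u\<^sup>2 \<le> 2 * l (2 * u) * F} \<and>
    measure M {\<omega> \<in> space M.
      (\<forall>t<T. sgd x0 \<eta> g t \<omega> \<in> X \<and> norm (gradient f (sgd x0 \<eta> g t \<omega>)) \<le> G) \<and>
      (1 / real T) * (\<Sum>t<T. (norm (gradient f (sgd x0 \<eta> g t \<omega>)))\<^sup>2) \<le> \<epsilon>\<^sup>2} \<ge> 1 - \<delta>"
    (is "?bdd \<and> 1 - \<delta> \<le> measure M ?E")
proof -
  interpret prob_space M
    by fact
  note l = \<open>mono_on {0..} l\<close> assms(6)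
  define fmin where "fmin = (INF x\<in>X. f x)"
  have lower: "fmin \<le> f x" if "x \<in> X" for x
    unfolding fmin_def using \<open>bdd_below (f ` X)\<close> that by (rule cINF_lower)
  have diff: "f differentiable_on X"
    using \<open>ell_smooth_on l X f\<close> by (simp add: ell_smooth_on_def)
  have "0 \<le> F"
    using lower[OF \<open>x0 \<in> X\<close>] \<open>0 \<le> \<sigma>\<close> \<open>0 < \<delta>\<close> by (simp add: F fmin_def)
  have bdd: ?bdd
    using \<open>subquadratic l\<close> \<open>0 \<le> F\<close> by (rule bdd_above_gradient_levels)
  have T: "0 < T"
    using \<open>T \<ge> 1\<close> by simp
  have avg: "(1 / real T) * s \<le> \<epsilon>\<^sup>2 \<longleftrightarrow> s \<le> real T * \<epsilon>\<^sup>2" for s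
    using T by (simp add: field_simps)
  have g: "g t \<in> borel_measurable M" for t
    using \<open>noise_assumption M X f x0 \<eta> g \<sigma>\<close> by (simp add: noise_assumption_def)
  have E: "?E \<in> events"
    unfolding avg by (rule sgd_event_measurable[OF \<open>open X\<close> diff g])
  have "1 - \<delta> \<le> prob ?E"
  proof (cases "F = 0")
    case False
    then have "0 < F"
      using \<open>0 \<le> F\<close> by simp
    note G' = Sup_gradient_levels_pos[OF l \<open>0 < F\<close> bdd G]
    have level: "u \<le> G" if "u \<ge> 0" "u\<^sup>2 \<le> 2 * l (2 * u) * F" for u
      unfolding G using that bdd by (intro cSup_upper) auto
    let ?E' = "{\<omega> \<in> space M.
      (\<forall>t<T. sgd x0 \<eta> g t \<omega> \<in> X \<and> norm (gradient f (sgd x0 \<eta> g t \<omega>)) \<le> G) \<and>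
      (\<Sum>t<T. (norm (gradient f (sgd x0 \<eta> g t \<omega>)))\<^sup>2) \<le> F / \<eta>}"
    have "F / \<eta> = F / (\<eta> * \<epsilon>\<^sup>2) * \<epsilon>\<^sup>2"
      using \<open>0 < \<epsilon>\<close> by simp
    also have "\<dots> \<le> real T * \<epsilon>\<^sup>2"
      using \<open>real T \<ge> F / (\<eta> * \<epsilon>\<^sup>2)\<close> by (rule mult_right_mono) simp
    finally have "?E' \<subseteq> ?E"
      unfolding avg by auto
    then have "prob ?E' \<le> prob ?E"
      using E by (rule finite_measure_mono)
    moreover have "1 - \<delta> \<le> prob ?E'"
    proof (rule sgd_high_probability[OF \<open>open X\<close> assms(2) \<open>ell_smooth_on l X f\<close> l \<open>x0 \<in> X\<close> lower
          \<open>\<sigma> \<ge> 0\<close> \<open>noise_assumption M X f x0 \<eta> g \<sigma>\<close> \<open>0 < \<delta>\<close> \<open>\<delta> < 1\<close> _ \<open>0 < F\<close> G' level \<open>\<eta> > 0\<close> _ _ T])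
      show "F = 8 * (f x0 - fmin + \<sigma>) / \<delta>"
        by (simp add: F fmin_def)
      show "\<eta> \<le> 1 / (2 * l (2 * G))"
        using \<open>\<eta> \<le> 1 / (2 * L)\<close> by (simp add: L)
      show "\<eta> \<le> 1 / (4 * G * sqrt (real T))"
        using assms(22) G'(1) by simp
    qed
    ultimately show ?thesis
      by linarith
  next
    case True
    then have "f x0 - fmin + \<sigma> = 0"
      using \<open>0 < \<delta>\<close> by (simp add: F fmin_def)
    then have "\<sigma> = 0" and f0: "f x0 - fmin = 0"
      using lower[OF \<open>x0 \<in> X\<close>] \<open>0 \<le> \<sigma>\<close> by linarith+
    have "(norm (gradient f x0))\<^sup>2 \<le> 2 * l (2 * norm (gradient f x0)) * (f x0 - fmin)"
      by (rule gradient_norm_bound[OF \<open>open X\<close> assms(2) \<open>ell_smooth_on l X f\<close> l \<open>x0 \<in> X\<close> lower])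
    then have crit: "gradient f x0 = 0"
      by (simp add: f0)
    have "{u. u \<ge> 0 \<and> u\<^sup>2 \<le> 2 * l (2 * u) * F} = {0}"
      using True by auto
    then have "G = 0"
      by (simp add: G)
    have "AE \<omega> in M. \<forall>t. sgd x0 \<eta> g t \<omega> = x0"
      using \<open>noise_assumption M X f x0 \<eta> g \<sigma>\<close> unfolding \<open>\<sigma> = 0\<close>
      by (rule sgd_constant_if_noiseless_at_critical_point[OF \<open>open X\<close> diff \<open>x0 \<in> X\<close> crit])
    then have "prob ?E = 1"
      unfolding prob_Collect_eq_1[OF E]
      by eventually_elim (simp add: \<open>x0 \<in> X\<close> crit \<open>G = 0\<close>)
    then show ?thesis
      using \<open>0 < \<delta>\<close> by simp
  qed
  with bdd show ?thesis
    by blast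
qed

end
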